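(* Let $\alpha>0$ and $0\le\beta\le\alpha$, and let $\mathbf{X}_0(s)=(\cos_{\alpha\beta}(s),0,0)$. Consider a perturbation of $\mathbf{X}_0$ given by $$\mathbf{X}(\mu,s)=\mathbf{X}_0(s)+\mu\,\mathbf{x}_1(s)+o(\mu)\quad\text{in }H^1\quad(\mu\to0),$$ and let the corresponding expansion of $\mathcal{L}$ be $$\mathcal{L}(\mathbf{X}(\mu,\cdot))=\mathcal{L}(\mathbf{X}_0)+\mu\,\mathcal{L}_1+o(\mu).$$ Suppose that the first component of the constraint $\int_0^{2\pi}\frac{\mathbf{X}(\mu,s)}{|\mathbf{X}(\mu,s)|}\,ds=0$ is satisfied to order $o(\mu)$, that is, the first component of this integral is $o(\mu)$ as $\mu\to0$. Then $\mu\,\mathcal{L}_1\ge0$. Moreover, for $\mu\ne0$ it is strictly positive unless either $\alpha=\beta>0$ or $\mathbf{x}_1(\pi/2)=\mathbf{x}_1(3\pi/2)=0$.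
   Context: All vector-valued functions are $2\pi$-periodic with values in $\mathbb{R}^3$, and $H^1$ is the Sobolev space of such functions ($\mathbf{x}_1\in H^1$). The orbits $\mathbf{X}(\mu,\cdot)$, $\mu\neq0$, are assumed to vanish only on a set of measure zero, so that the constraint integral makes sense. The parameter $\mu$ is real and small. The functional is $$\mathcal{L}(\mathbf{X})=\frac12\int_0^{2\pi}\big\{|\mathbf{X}'(s)|^2-|\mathbf{X}(s)|^2\big\}\,ds,$$ and $$\cos_{\alpha\beta}(s)=\begin{cases}\alpha\cos s,& -\pi/2\le s\le\pi/2,\\ \beta\cos s,&\pi/2\le s\le3\pi/2,\end{cases}$$ extended $2\pi$-periodically. *)

theory Defs
  imports "HOL-Analysis.Analysis" "HOL-Library.Landau_Symbols" "HOL-Library.Real_Mod"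
begin

text \<open>
  Periodic Sobolev space of \<open>2\<pi>\<close>-periodic functions with values in \<open>\<real>\<^sup>3\<close>. Square-integrability is
  over one period. Weak derivatives are tested against periodic \<open>C\<^sup>1\<close> functions; a continuous
  derivative \<open>\<phi>'\<close> of such a \<open>\<phi>\<close> is automatically periodic.
\<close>

definition L2_per :: "(real \<Rightarrow> real^3) set" where
  "L2_per = {g. periodic_fun_simple g (2*pi) \<and> g \<in> borel_measurable lborel \<and>
                set_integrable lborel {0..2*pi} (\<lambda>s. (norm (g s))\<^sup>2)}"

definition is_weak_deriv :: "(real \<Rightarrow> real^3) \<Rightarrow> (real \<Rightarrow> real^3) \<Rightarrow> bool" where
  "is_weak_deriv f g \<longleftrightarrow>
     (\<forall>\<phi> \<phi>' :: real \<Rightarrow> real.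
        periodic_fun_simple \<phi> (2*pi) \<and> (\<forall>s. (\<phi> has_real_derivative \<phi>' s) (at s)) \<and>
        continuous_on UNIV \<phi>' \<longrightarrow>
        (LINT s:{0..2*pi}|lborel. \<phi>' s *\<^sub>R f s) = - (LINT s:{0..2*pi}|lborel. \<phi> s *\<^sub>R g s))"

text \<open>
  Elements of \<open>H\<^sup>1\<close> are represented by their (unique) continuous representatives, so that point
  values make sense; a continuous periodic function lies in \<open>L2_per\<close>.
\<close>

definition H1_per :: "(real \<Rightarrow> real^3) set" where
  "H1_per = {f. periodic_fun_simple f (2*pi) \<and> continuous_on UNIV f \<and>
                (\<exists>g\<in>L2_per. is_weak_deriv f g)}"

text \<open>Unique only up to null sets, and meaningful only for \<open>f \<in> H1_per\<close>.\<close>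

definition weak_deriv :: "(real \<Rightarrow> real^3) \<Rightarrow> real \<Rightarrow> real^3" where
  "weak_deriv f = (SOME g. g \<in> L2_per \<and> is_weak_deriv f g)"

definition H1_norm :: "(real \<Rightarrow> real^3) \<Rightarrow> real" where
  "H1_norm f = sqrt (LINT s:{0..2*pi}|lborel. (norm (f s))\<^sup>2 + (norm (weak_deriv f s))\<^sup>2)"

definition lagr :: "(real \<Rightarrow> real^3) \<Rightarrow> real" where
  "lagr X = (1/2) * (LINT s:{0..2*pi}|lborel. (norm (weak_deriv X s))\<^sup>2 - (norm (X s))\<^sup>2)"

text \<open>The argument \<open>s\<close> is first reduced modulo \<open>2\<pi>\<close> to \<open>[-\<pi>/2, 3\<pi>/2)\<close>.\<close>

definition cos_ab :: "real \<Rightarrow> real \<Rightarrow> real \<Rightarrow> real" where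
  "cos_ab \<alpha> \<beta> s =
     (let t = (s + pi/2) rmod (2*pi) - pi/2
      in if t \<le> pi/2 then \<alpha> * cos t else \<beta> * cos t)"

lemma cos_ab_left: "- pi/2 \<le> s \<Longrightarrow> s \<le> pi/2 \<Longrightarrow> cos_ab \<alpha> \<beta> s = \<alpha> * cos s"
proof -
  assume s: "- pi/2 \<le> s" "s \<le> pi/2"
  have "(s + pi/2) rmod (2*pi) = s + pi/2"
  proof (rule rmod_idem)
    have "0 \<le> s + pi/2" "s + pi/2 < 2*pi" "\<bar>2*pi\<bar> = 2*pi"
      using s pi_gt_zero by linarith+
    then show "s + pi/2 \<in> {0..<\<bar>2*pi\<bar>}" by simp
  qed
  then show ?thesis
    using s by (simp add: cos_ab_def)
qed

lemma cos_ab_periodic: "periodic_fun_simple (cos_ab \<alpha> \<beta>) (2*pi)"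
proof
  fix s
  have "(s + 2*pi + pi/2) rmod (2*pi) = (s + pi/2) rmod (2*pi)"
    using rmod_add[of "s + pi/2" "2*pi" "2*pi"] by (simp add: add_ac)
  then show "cos_ab \<alpha> \<beta> (s + 2*pi) = cos_ab \<alpha> \<beta> s"
    by (simp add: cos_ab_def)
qed

lemma cos_ab_right: "pi/2 \<le> s \<Longrightarrow> s \<le> 3*pi/2 \<Longrightarrow> cos_ab \<alpha> \<beta> s = \<beta> * cos s"
proof -
  assume s: "pi/2 \<le> s" "s \<le> 3*pi/2"
  consider "s = pi/2" | "s = 3*pi/2" | "pi/2 < s" "s < 3*pi/2"
    using s by linarith
  then show ?thesis
  proof cases
    case 1
    show ?thesis
      unfolding 1 using cos_ab_left[of "pi/2" \<alpha> \<beta>] pi_gt_zero by simp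
  next
    case 2
    have "cos_ab \<alpha> \<beta> (- pi/2 + 2*pi) = cos_ab \<alpha> \<beta> (- pi/2)"
      using cos_ab_periodic by (simp only: periodic_fun_simple_def)
    moreover have "cos (3*pi/2) = 0"
      using cos_3over2_pi by (simp add: field_simps)
    ultimately show ?thesis
      unfolding 2 using cos_ab_left[of "- pi/2" \<alpha> \<beta>] pi_gt_zero by simp
  next
    case 3
    have "(s + pi/2) rmod (2*pi) = s + pi/2"
      by (rule rmod_idem) (use 3 pi_gt_zero in auto)
    then show ?thesis
      using 3 by (simp add: cos_ab_def)
  qed
qed

definition X0 :: "real \<Rightarrow> real \<Rightarrow> real \<Rightarrow> real^3" where
  "X0 \<alpha> \<beta> s = vector [cos_ab \<alpha> \<beta> s, 0, 0]"

definition constraint_integral :: "(real \<Rightarrow> real^3) \<Rightarrow> real^3" where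
  "constraint_integral X = (LINT s:{0..2*pi}|lborel. X s /\<^sub>R norm (X s))"

end

theory Submission
  imports Defs
begin

text \<open>
  The theorem rests on two exact first-order computations. Write \<open>X = X\<^sub>0 + \<mu> x\<^sub>1 + o(\<mu>)\<close>, put
  \<open>y = \<mu> x\<^sub>1\<close>, and let \<open>y\<^sub>1\<close> be the first component of \<open>y\<close>.

  \<^emph>\<open>The functional.\<close> It is quadratic, and \<open>X\<^sub>0\<close> solves \<open>X'' + X = 0\<close> except for a jump of its
  derivative at \<open>\<pi>/2\<close> and \<open>3\<pi>/2\<close>. Integration by parts leaves only those two corners
  (lemma \<open>lagr_X0_plus\<close>), so that
  \<open>\<mu> L\<^sub>1 = - (\<alpha> - \<beta>) (y\<^sub>1(\<pi>/2) + y\<^sub>1(3\<pi>/2))\<close>.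

  \<^emph>\<open>The constraint.\<close> Let \<open>\<beta> > 0\<close>. Away from the two zeros of the cosine the first component of
  \<open>X / |X|\<close> deviates from \<open>\<plusminus>1\<close> only to second order. All of the first-order effect comes from a neighbourhood of width
  of order \<open>\<mu>\<close> of the two points. On one side of such a point \<open>p\<close> the curve looks, after
  rescaling, like the ray \<open>\<kappa> t e + U\<close> with \<open>U = y(p)\<close>, where \<open>\<kappa>\<close> is \<open>\<alpha>\<close> or \<open>\<beta>\<close> and \<open>e = \<plusminus>e\<^sub>1\<close>. Since
  \<open>\<kappa> (V \<bullet> e) / |V|\<close> is the derivative of \<open>|V|\<close> along \<open>V = \<kappa> t e + U\<close>, the integral of
  \<open>(V \<bullet> e) / |V| - 1\<close> over the half line \<open>t \<ge> 0\<close> is \<open>(U \<bullet> e - |U|) / \<kappa>\<close> (lemma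
  \<open>limit_transversal\<close>). Adding the four sides, the constraint becomes (lemma \<open>balance\<close>)
  \<open>(\<alpha> + \<beta>) (y\<^sub>1(\<pi>/2) + y\<^sub>1(3\<pi>/2)) = - (\<alpha> - \<beta>) (|y(\<pi>/2)| + |y(3\<pi>/2)|)\<close>.
  For \<open>\<beta> = 0\<close> the two inner sides degenerate. There, the constraint bounds the scaled integral, which
  forces \<open>y(p)\<close> to point in the direction \<open>-e\<^sub>1\<close> unless it is zero (lemma \<open>limit_degenerate\<close>), and this gives the same
  relation.

  Together the two relations give
  \<open>(\<alpha> + \<beta>) \<mu> L\<^sub>1 = (\<alpha> - \<beta>)\<^sup>2 |\<mu>| (|x\<^sub>1(\<pi>/2)| + |x\<^sub>1(3\<pi>/2)|)\<close>,
  from which both claims can be read off.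

  Making point values meaningful requires a little one-dimensional Sobolev theory: a continuous
  function with a square-integrable weak derivative is the primitive of that derivative
  (lemma \<open>H1_per_eq_primitive\<close>). Hence the weak derivative is unique, the supremum is bounded by the
  \<open>H\<^sup>1\<close> norm, and integration by parts holds.
\<close>

section \<open>Integration on intervals and periodic functions\<close>


lemma set_integrable_continuous_scaleR:
  fixes \<phi> :: "real \<Rightarrow> real" and g :: "real \<Rightarrow> 'a::euclidean_space"
  assumes "continuous_on {a..b} \<phi>" and "set_integrable lborel {a..b} g"
  shows "set_integrable lborel {a..b} (\<lambda>s. \<phi> s *\<^sub>R g s)"
proof -
  obtain B where B: "\<And>s. s \<in> {a..b} \<Longrightarrow> norm (\<phi> s) \<le> B"
    using compact_imp_bounded[OF compact_continuous_image[OF assms(1) compact_Icc]]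
    unfolding bounded_iff by fastforce
  have m: "(\<lambda>s. (indicator {a..b} s *\<^sub>R \<phi> s) *\<^sub>R (indicator {a..b} s *\<^sub>R g s)) \<in> borel_measurable lborel"
    using borel_integrable_atLeastAtMost'[OF assms(1)] assms(2) unfolding set_integrable_def
    by (intro borel_measurable_scaleR borel_measurable_integrable)
  have eq: "(\<lambda>s. (indicator {a..b} s *\<^sub>R \<phi> s) *\<^sub>R (indicator {a..b} s *\<^sub>R g s))
      = (\<lambda>s. indicator {a..b} s *\<^sub>R (\<phi> s *\<^sub>R g s))"
    by (auto simp: indicator_def)
  show ?thesis
  proof (rule set_integrable_bound)
    show "set_integrable lborel {a..b} (\<lambda>s. B *\<^sub>R g s)"
      using assms(2) by simp
    show "set_borel_measurable lborel {a..b} (\<lambda>s. \<phi> s *\<^sub>R g s)"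
      using m unfolding eq set_borel_measurable_def .
    show "AE s in lborel. s \<in> {a..b} \<longrightarrow> norm (\<phi> s *\<^sub>R g s) \<le> norm (B *\<^sub>R g s)"
    proof (intro AE_I2 impI)
      fix s assume "s \<in> {a..b}"
      then have "\<bar>\<phi> s\<bar> \<le> \<bar>B\<bar>" using B[of s] by simp
      then show "norm (\<phi> s *\<^sub>R g s) \<le> norm (B *\<^sub>R g s)"
        by (simp add: mult_right_mono)
    qed
  qed
qed

lemma set_integral_scaleR_const:
  fixes k :: "'b \<Rightarrow> real" and c :: "'a::{banach, second_countable_topology}"
  assumes "set_integrable M A k"
  shows "(LINT s:A|M. k s *\<^sub>R c) = (LINT s:A|M. k s) *\<^sub>R c"
  using integral_scaleR_left[of c M "\<lambda>s. indicator A s *\<^sub>R k s"] assms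
  by (simp add: set_lebesgue_integral_def set_integrable_def)

lemma set_integral_FTC_real:
  fixes F f :: "real \<Rightarrow> real"
  assumes "a \<le> b" and "\<And>x. (F has_real_derivative f x) (at x)" and "continuous_on UNIV f"
  shows "(LINT s:{a..b}|lborel. f s) = F b - F a"
  using integral_FTC_Icc_real[OF assms(1), of F f] assms(2,3)
  by (simp add: set_lebesgue_integral_def mult.commute continuous_on_eq_continuous_at)

text \<open>
  Both sides are the iterated integrals of \<open>\<phi>' t *\<^sub>R g s\<close> over the triangle \<open>a \<le> s \<le> t \<le> b\<close>, taken in
  the two possible orders. Going through Fubini avoids differentiating the primitive of \<open>g\<close>, which
  in general is only possible almost everywhere.
\<close>
lemma integral_by_parts_primitive:
  fixes \<phi> \<phi>' :: "real \<Rightarrow> real" and g :: "real \<Rightarrow> 'a::euclidean_space"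
  assumes "a \<le> b" and g: "set_integrable lborel {a..b} g"
    and \<phi>: "\<And>x. (\<phi> has_real_derivative \<phi>' x) (at x)" and \<phi>': "continuous_on UNIV \<phi>'"
  shows "(LINT s:{a..b}|lborel. \<phi> s *\<^sub>R g s) =
    \<phi> b *\<^sub>R (LINT s:{a..b}|lborel. g s) - (LINT t:{a..b}|lborel. \<phi>' t *\<^sub>R (LINT s:{a..t}|lborel. g s))"
proof -
  define p where "p = (\<lambda>t. indicator {a..b} t *\<^sub>R \<phi>' t)"
  define q where "q = (\<lambda>s. indicator {a..b} s *\<^sub>R g s)"
  define K where "K = (\<lambda>(t, s). if s \<le> t then p t *\<^sub>R q s else 0)"
  have \<phi>'c: "continuous_on A \<phi>'" for A
    using \<phi>' continuous_on_subset by blast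
  have \<phi>c: "continuous_on A \<phi>" for A
    using \<phi> by (meson DERIV_isCont continuous_at_imp_continuous_on)
  have p: "integrable lborel p"
    using borel_integrable_atLeastAtMost'[OF \<phi>'c, of a b] by (simp add: p_def set_integrable_def)
  have q: "integrable lborel q"
    using g by (simp add: q_def set_integrable_def)
  note [measurable] = borel_measurable_integrable[OF p] borel_measurable_integrable[OF q]
  have pq: "integrable (lborel \<Otimes>\<^sub>M lborel) (\<lambda>x. p (fst x) *\<^sub>R q (snd x))"
  proof (rule lborel_pair.Fubini_integrable)
    show "(\<lambda>x. p (fst x) *\<^sub>R q (snd x)) \<in> borel_measurable (lborel \<Otimes>\<^sub>M lborel)"
      by measurable
    show "integrable lborel (\<lambda>x. \<integral>y. norm (p (fst (x, y)) *\<^sub>R q (snd (x, y))) \<partial>lborel)"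
      using p q by (simp add: integrable_norm)
    show "AE x in lborel. integrable lborel (\<lambda>y. p (fst (x, y)) *\<^sub>R q (snd (x, y)))"
      using q by simp
  qed
  have K: "integrable (lborel \<Otimes>\<^sub>M lborel) K"
  proof (rule Bochner_Integration.integrable_bound[OF pq])
    show "K \<in> borel_measurable (lborel \<Otimes>\<^sub>M lborel)"
      unfolding K_def by measurable
  qed (auto simp: K_def)
  have G: "(\<integral>s. K (t, s) \<partial>lborel) = indicator {a..b} t *\<^sub>R (\<phi>' t *\<^sub>R (LINT s:{a..t}|lborel. g s))" for t
  proof -
    have "(\<integral>s. K (t, s) \<partial>lborel) = (\<integral>s. p t *\<^sub>R (indicator {a..t} s *\<^sub>R g s) \<partial>lborel)"
      by (intro Bochner_Integration.integral_cong) (auto simp: K_def p_def q_def indicator_def)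
    also have "\<dots> = p t *\<^sub>R (\<integral>s. indicator {a..t} s *\<^sub>R g s \<partial>lborel)"
      by (rule integral_scaleR_right)
    finally show ?thesis
      by (simp add: p_def set_lebesgue_integral_def)
  qed
  have P: "(\<integral>t. K (t, s) \<partial>lborel) = indicator {a..b} s *\<^sub>R ((\<phi> b - \<phi> s) *\<^sub>R g s)" for s
  proof (cases "s \<in> {a..b}")
    case True
    have "(\<integral>t. K (t, s) \<partial>lborel) = (\<integral>t. (indicator {s..b} t *\<^sub>R \<phi>' t) *\<^sub>R g s \<partial>lborel)"
      using True by (intro Bochner_Integration.integral_cong) (auto simp: K_def p_def q_def indicator_def)
    also have "\<dots> = (LINT t:{s..b}|lborel. \<phi>' t) *\<^sub>R g s"
      unfolding set_lebesgue_integral_def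
      using borel_integrable_atLeastAtMost'[OF \<phi>'c, of s b]
      by (intro integral_scaleR_left) (simp add: set_integrable_def)
    also have "(LINT t:{s..b}|lborel. \<phi>' t) = \<phi> b - \<phi> s"
      using True by (intro set_integral_FTC_real[OF _ \<phi> \<phi>']) auto
    finally show ?thesis using True by simp
  next
    case False
    then have "K (t, s) = 0" for t
      by (auto simp: K_def q_def)
    with False show ?thesis by simp
  qed
  have "(LINT s:{a..b}|lborel. (\<phi> b - \<phi> s) *\<^sub>R g s) =
      (LINT t:{a..b}|lborel. \<phi>' t *\<^sub>R (LINT s:{a..t}|lborel. g s))"
    using lborel_pair.Fubini_integral[of "\<lambda>t s. K (t, s)"] K
    unfolding G P set_lebesgue_integral_def by simp
  moreover have "(LINT s:{a..b}|lborel. (\<phi> b - \<phi> s) *\<^sub>R g s) =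
      \<phi> b *\<^sub>R (LINT s:{a..b}|lborel. g s) - (LINT s:{a..b}|lborel. \<phi> s *\<^sub>R g s)"
    using set_integral_diff(2)[OF set_integrable_scaleR_right[of "\<phi> b", OF g]
        set_integrable_continuous_scaleR[OF \<phi>c g]]
    by (simp add: scaleR_left_diff_distrib)
  ultimately show ?thesis by (simp add: algebra_simps)
qed

text \<open>
  The test functions for weak derivatives are periodic on the whole line, whereas primitives of weak
  derivatives are controlled on one period only; this lemma passes from one to the other.
\<close>
lemma periodic_extension_continuous:
  fixes h :: "real \<Rightarrow> 'a::topological_space"
  assumes "p > 0" and h: "continuous_on {0..p} h" and "h 0 = h p"
  shows "\<exists>H. periodic_fun_simple H p \<and> continuous_on UNIV H \<and> (\<forall>s\<in>{0..p}. H s = h s)"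
proof -
  define H where "H s = h (s rmod p)" for s
  have per: "periodic_fun_simple H p"
  proof
    fix s show "H (s + p) = H s"
      using rmod_add[of s p p] \<open>p > 0\<close> by (simp add: H_def)
  qed
  interpret periodic_fun_simple H p by (rule per)
  have eq: "H s = h s" if "s \<in> {0..p}" for s
    using that \<open>p > 0\<close> \<open>h 0 = h p\<close> by (cases "s = p") (auto simp: H_def)
  have piece: "continuous_on {of_int k * p..of_int (k + 1) * p} H" for k
  proof -
    have "continuous_on {of_int k * p..of_int (k + 1) * p} (\<lambda>s. h (s - of_int k * p))"
      by (rule continuous_on_compose2[OF h]) (auto intro!: continuous_intros simp: algebra_simps)
    then show ?thesis
    proof (rule continuous_on_eq)
      fix s assume "s \<in> {of_int k * p..of_int (k + 1) * p}"
      then have "H (s - of_int k * p) = h (s - of_int k * p)"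
        by (intro eq) (auto simp: algebra_simps)
      then show "h (s - of_int k * p) = H s"
        by (simp add: minus_of_int)
    qed
  qed
  have "isCont H x" for x
  proof -
    define k where "k = \<lfloor>x / p\<rfloor>"
    have k: "of_int k * p \<le> x" "x < of_int (k + 1) * p"
      unfolding k_def using \<open>p > 0\<close>
      by (auto simp flip: pos_le_divide_eq pos_divide_less_eq)
    have "continuous_on ({of_int (k - 1) * p..of_int k * p} \<union> {of_int k * p..of_int (k + 1) * p}) H"
      using piece[of "k - 1"] piece[of k] by (intro continuous_on_closed_Un) auto
    moreover have "x \<in> interior ({of_int (k - 1) * p..of_int k * p} \<union> {of_int k * p..of_int (k + 1) * p})"
    proof (rule interiorI)
      show "open {of_int (k - 1) * p <..< of_int (k + 1) * p}" by simp
      show "x \<in> {of_int (k - 1) * p <..< of_int (k + 1) * p}"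
        using k \<open>p > 0\<close> by (auto simp: algebra_simps)
    qed auto
    ultimately show ?thesis
      by (rule continuous_on_interior)
  qed
  then have "continuous_on UNIV H"
    by (simp add: continuous_on_eq_continuous_at)
  with per eq show ?thesis by blast
qed

text \<open>
  The integral of \<open>q\<close> is the increment of a primitive over one period, and this increment is the same
  everywhere because \<open>q\<close> is periodic.
\<close>
lemma periodic_primitive_exists:
  fixes q :: "real \<Rightarrow> real"
  assumes per: "periodic_fun_simple q p" and q: "continuous_on UNIV q" and "p > 0"
    and mean: "(LINT s:{0..p}|lborel. q s) = 0"
  shows "\<exists>\<phi>. periodic_fun_simple \<phi> p \<and> (\<forall>s. (\<phi> has_real_derivative q s) (at s))"
proof -
  interpret periodic_fun_simple q p by (rule per)
  define \<phi> where "\<phi> u = (LBINT y=0..ereal u. q y)" for u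
  have d: "(\<phi> has_real_derivative q s) (at s)" for s
  proof -
    have "(\<phi> has_vector_derivative q s) (at s within {-\<bar>s\<bar>-1..\<bar>s\<bar>+1})"
      unfolding \<phi>_def[abs_def] zero_ereal_def
      by (rule interval_integral_FTC2) (auto intro: continuous_on_subset[OF q])
    then show ?thesis
      by (subst (asm) at_within_interior) (auto simp: has_real_derivative_iff_has_vector_derivative)
  qed
  have "((\<lambda>s. \<phi> (s + p) - \<phi> s) has_real_derivative 0) (at s)" for s
    using DERIV_shift[of \<phi> "q s" s p] d[of "s + p"] d[of s] plus_period[of s]
    by (auto intro!: derivative_eq_intros)
  then have "\<phi> (s + p) - \<phi> s = \<phi> (0 + p) - \<phi> 0" for s
    by (intro DERIV_isconst_all[of "\<lambda>s. \<phi> (s + p) - \<phi> s"]) auto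
  also have "\<phi> (0 + p) - \<phi> 0 = 0"
    using mean set_integral_FTC_real[OF _ d q, of 0 p] \<open>p > 0\<close> by simp
  finally have "periodic_fun_simple \<phi> p"
    by unfold_locales simp
  with d show ?thesis by blast
qed

lemma set_integral_vec_nth:
  fixes f :: "'b \<Rightarrow> real ^ 'n"
  assumes "set_integrable M S f"
  shows "set_integrable M S (\<lambda>s. f s $ i)" and "(LINT s:S|M. f s) $ i = (LINT s:S|M. f s $ i)"
  using integrable_bounded_linear[OF bounded_linear_vec_nth assms[unfolded set_integrable_def], of i]
    integral_bounded_linear[OF bounded_linear_vec_nth assms[unfolded set_integrable_def], of i]
  by (simp_all add: set_integrable_def set_lebesgue_integral_def)

text \<open>
  The Borel sets over which \<open>d\<close> integrates to zero are closed under complements and disjoint countable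
  unions, and they contain the rays \<open>{..x}\<close>, which generate the Borel sets.
\<close>
lemma AE_zero_if_primitive_zero:
  fixes d :: "real \<Rightarrow> 'a::{second_countable_topology, banach}"
  assumes "a \<le> b" and d: "set_integrable lborel {a..b} d"
    and z: "\<And>x. x \<in> {a..b} \<Longrightarrow> (LINT s:{a..x}|lborel. d s) = 0"
  shows "AE s in lborel. s \<in> {a..b} \<longrightarrow> d s = 0"
proof -
  define D where "D = (\<lambda>s. indicator {a..b} s *\<^sub>R d s)"
  have D: "integrable lborel D"
    using d by (simp add: D_def set_integrable_def)
  have Dset: "set_integrable lborel B D" if "B \<in> sets borel" for B
    using integrable_mult_indicator[OF _ D, of B] that by (simp add: set_integrable_def)
  have ray: "(LINT s:{..x}|lborel. D s) = 0" for x
  proof (cases "x < a")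
    case True
    then have "(\<lambda>s. indicator {..x} s *\<^sub>R D s) = (\<lambda>s. 0)"
      by (auto simp: D_def indicator_def)
    then show ?thesis
      by (simp only: set_lebesgue_integral_def integral_zero)
  next
    case False
    then have eq: "(\<lambda>s. indicator {..x} s *\<^sub>R D s) = (\<lambda>s. indicator {a..min x b} s *\<^sub>R d s)"
      by (auto simp: D_def indicator_def)
    show ?thesis
      using z[of "min x b"] False \<open>a \<le> b\<close> unfolding set_lebesgue_integral_def eq by simp
  qed
  have all: "(LINT s:UNIV|lborel. D s) = 0"
    using ray[of b] z[of b] \<open>a \<le> b\<close> by (simp add: set_lebesgue_integral_def D_def)
  have "(LINT s:B|lborel. D s) = 0" if "B \<in> sets lborel" for B
  proof -
    have "Int_stable (range (\<lambda>x::real. {..x}))"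
      by (auto simp: Int_stable_def Int_atMost)
    moreover have "range (\<lambda>x::real. {..x}) \<subseteq> Pow UNIV"
      by simp
    moreover have "B \<in> sigma_sets UNIV (range (\<lambda>x::real. {..x}))"
      using that by (simp add: borel_eq_atMost)
    ultimately show ?thesis
    proof (induction rule: sigma_sets_induct_disjoint)
      case (basic B)
      then show ?case using ray by auto
    next
      case empty
      show ?case by (simp add: set_lebesgue_integral_def)
    next
      case (compl B)
      have B: "B \<in> sets borel"
        using compl by (simp add: borel_eq_atMost)
      have "(LINT s:B \<union> (UNIV - B)|lborel. D s) = (LINT s:B|lborel. D s) + (LINT s:UNIV - B|lborel. D s)"
        using B by (intro set_integral_Un Dset) auto
      then show ?case using compl all by simp
    next
      case (union B)
      have B: "B i \<in> sets borel" for i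
        using union by (auto simp: borel_eq_atMost)
      have "(LINT s:(\<Union>i. B i)|lborel. D s) = (\<Sum>i. LINT s:B i|lborel. D s)"
        using B union by (intro lebesgue_integral_countable_add Dset) (auto simp: disjoint_family_on_def)
      then show ?case using union by simp
    qed
  qed
  then have "AE s in lborel. D s = 0"
    by (intro sigma_finite_measure.density_zero[OF sigma_finite_lborel] D)
  then show ?thesis
    by eventually_elim (auto simp: D_def)
qed

section \<open>Periodic Sobolev functions\<close>

lemma L2_per_measurable: "g \<in> L2_per \<Longrightarrow> g \<in> borel_measurable borel"
  by (simp add: L2_per_def)

lemma L2_per_set_integrable:
  assumes "g \<in> L2_per" shows "set_integrable lborel {0..2*pi} g"
proof (rule set_integrable_bound)
  show "set_integrable lborel {0..2*pi} (\<lambda>s. 1 + (norm (g s))\<^sup>2)"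
    using assms borel_integrable_atLeastAtMost'[of 0 "2*pi" "\<lambda>s. 1::real"]
    by (intro set_integral_add) (auto simp: L2_per_def)
  show "set_borel_measurable lborel {0..2*pi} g"
    using L2_per_measurable[OF assms] unfolding set_borel_measurable_def by simp
  have "norm x \<le> 1 + (norm x)\<^sup>2" for x :: "real^3"
    using sum_power2_ge_zero[of "norm x - 1/2" 0] by (simp add: power2_eq_square algebra_simps)
  then show "AE s in lborel. s \<in> {0..2*pi} \<longrightarrow> norm (g s) \<le> norm (1 + (norm (g s))\<^sup>2)"
    by (auto intro: order_trans)
qed

lemma L2_per_inner_set_integrable:
  assumes "g \<in> L2_per" and "h \<in> L2_per"
  shows "set_integrable lborel {0..2*pi} (\<lambda>s. g s \<bullet> h s)"
proof (rule set_integrable_bound)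
  show "set_integrable lborel {0..2*pi} (\<lambda>s. (norm (g s))\<^sup>2 + (norm (h s))\<^sup>2)"
    using assms by (intro set_integral_add) (auto simp: L2_per_def)
  show "set_borel_measurable lborel {0..2*pi} (\<lambda>s. g s \<bullet> h s)"
    using assms[THEN L2_per_measurable] unfolding set_borel_measurable_def by simp
  have "\<bar>x \<bullet> y\<bar> \<le> (norm x)\<^sup>2 + (norm y)\<^sup>2" for x y :: "real^3"
  proof -
    have "\<bar>x \<bullet> y\<bar> \<le> norm x * norm y" by (rule Cauchy_Schwarz_ineq2)
    also have "\<dots> \<le> (norm x)\<^sup>2 + (norm y)\<^sup>2"
      using sum_squares_bound[of "norm x" "norm y"] mult_nonneg_nonneg[OF norm_ge_zero norm_ge_zero, of x y]
      by linarith
    finally show ?thesis .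
  qed
  then show "AE s in lborel. s \<in> {0..2*pi} \<longrightarrow> norm (g s \<bullet> h s) \<le> norm ((norm (g s))\<^sup>2 + (norm (h s))\<^sup>2)"
    by simp
qed

lemma L2_per_add:
  assumes "g \<in> L2_per" and "h \<in> L2_per"
  shows "(\<lambda>s. g s + h s) \<in> L2_per"
proof -
  have "set_integrable lborel {0..2*pi} (\<lambda>s. (norm (g s))\<^sup>2 + 2 * (g s \<bullet> h s) + (norm (h s))\<^sup>2)"
    using assms L2_per_inner_set_integrable[OF assms]
    by (intro set_integral_add) (auto simp: L2_per_def)
  also have "(\<lambda>s. (norm (g s))\<^sup>2 + 2 * (g s \<bullet> h s) + (norm (h s))\<^sup>2) = (\<lambda>s. (norm (g s + h s))\<^sup>2)"
    by (simp add: power2_norm_eq_inner inner_add inner_commute algebra_simps)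
  finally have "set_integrable lborel {0..2*pi} (\<lambda>s. (norm (g s + h s))\<^sup>2)" .
  then show ?thesis
    using assms by (auto simp: L2_per_def periodic_fun_simple_def)
qed

lemma L2_per_scaleR:
  assumes "g \<in> L2_per" shows "(\<lambda>s. c *\<^sub>R g s) \<in> L2_per"
  using assms by (auto simp: L2_per_def periodic_fun_simple_def power_mult_distrib)

lemma continuous_periodic_in_L2_per:
  assumes "periodic_fun_simple f (2*pi)" and "continuous_on UNIV f"
  shows "f \<in> L2_per"
proof -
  have "set_integrable lborel {0..2*pi} (\<lambda>s. (norm (f s))\<^sup>2)"
    by (intro borel_integrable_atLeastAtMost' continuous_intros continuous_on_subset[OF assms(2)]) auto
  then show ?thesis
    using assms by (simp add: L2_per_def borel_measurable_continuous_onI)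
qed

lemma H1_per_in_L2_per: "f \<in> H1_per \<Longrightarrow> f \<in> L2_per"
  by (simp add: H1_per_def continuous_periodic_in_L2_per)

lemma is_weak_deriv_add:
  assumes "f \<in> L2_per" "f' \<in> L2_per" "g \<in> L2_per" "g' \<in> L2_per" "is_weak_deriv f f'" "is_weak_deriv g g'"
  shows "is_weak_deriv (\<lambda>s. f s + g s) (\<lambda>s. f' s + g' s)"
  unfolding is_weak_deriv_def
proof (intro allI impI; elim conjE)
  fix \<phi> \<phi>' :: "real \<Rightarrow> real"
  assume t: "periodic_fun_simple \<phi> (2*pi)" "\<forall>s. (\<phi> has_real_derivative \<phi>' s) (at s)" "continuous_on UNIV \<phi>'"
  have c: "continuous_on {0..2*pi} \<phi>" "continuous_on {0..2*pi} \<phi>'"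
    using t by (auto intro: continuous_on_subset DERIV_isCont continuous_at_imp_continuous_on)
  note i = set_integrable_continuous_scaleR[OF c(1) L2_per_set_integrable]
    set_integrable_continuous_scaleR[OF c(2) L2_per_set_integrable]
  have "(LINT s:{0..2*pi}|lborel. \<phi>' s *\<^sub>R f s) = - (LINT s:{0..2*pi}|lborel. \<phi> s *\<^sub>R f' s)"
    "(LINT s:{0..2*pi}|lborel. \<phi>' s *\<^sub>R g s) = - (LINT s:{0..2*pi}|lborel. \<phi> s *\<^sub>R g' s)"
    using assms t unfolding is_weak_deriv_def by blast+
  then show "(LINT s:{0..2*pi}|lborel. \<phi>' s *\<^sub>R (f s + g s)) = - (LINT s:{0..2*pi}|lborel. \<phi> s *\<^sub>R (f' s + g' s))"
    using assms(1-4) by (simp add: scaleR_add_right set_integral_add(2) i)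
qed

lemma is_weak_deriv_scaleR:
  assumes "is_weak_deriv f f'"
  shows "is_weak_deriv (\<lambda>s. c *\<^sub>R f s) (\<lambda>s. c *\<^sub>R f' s)"
  unfolding is_weak_deriv_def
proof (intro allI impI)
  fix \<phi> \<phi>' :: "real \<Rightarrow> real"
  assume "periodic_fun_simple \<phi> (2*pi) \<and> (\<forall>s. (\<phi> has_real_derivative \<phi>' s) (at s)) \<and> continuous_on UNIV \<phi>'"
  then have "(LINT s:{0..2*pi}|lborel. \<phi>' s *\<^sub>R f s) = - (LINT s:{0..2*pi}|lborel. \<phi> s *\<^sub>R f' s)"
    using assms unfolding is_weak_deriv_def by blast
  moreover have "(LINT s:{0..2*pi}|lborel. \<psi> s *\<^sub>R (c *\<^sub>R k s)) = c *\<^sub>R (LINT s:{0..2*pi}|lborel. \<psi> s *\<^sub>R k s)"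
    for \<psi> :: "real \<Rightarrow> real" and k :: "real \<Rightarrow> real^3"
    unfolding scaleR_left_commute[of _ c] by (rule set_integral_scaleR_right)
  ultimately show "(LINT s:{0..2*pi}|lborel. \<phi>' s *\<^sub>R (c *\<^sub>R f s)) = - (LINT s:{0..2*pi}|lborel. \<phi> s *\<^sub>R (c *\<^sub>R f' s))"
    by simp
qed

lemma H1_per_add:
  assumes "f \<in> H1_per" and "g \<in> H1_per" shows "(\<lambda>s. f s + g s) \<in> H1_per"
proof -
  obtain f' g' where "f' \<in> L2_per" "g' \<in> L2_per" "is_weak_deriv f f'" "is_weak_deriv g g'"
    using assms by (auto simp: H1_per_def)
  then show ?thesis
    using assms is_weak_deriv_add[of f f' g g'] L2_per_add[of f' g'] assms[THEN H1_per_in_L2_per]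
    by (auto simp: H1_per_def periodic_fun_simple_def intro!: continuous_intros)
qed

lemma H1_per_scaleR:
  assumes "f \<in> H1_per" shows "(\<lambda>s. c *\<^sub>R f s) \<in> H1_per"
proof -
  obtain f' where "f' \<in> L2_per" "is_weak_deriv f f'"
    using assms by (auto simp: H1_per_def)
  then show ?thesis
    using assms is_weak_deriv_scaleR[of f f' c] L2_per_scaleR[of f' c]
    by (auto simp: H1_per_def periodic_fun_simple_def intro!: continuous_intros)
qed

lemma H1_per_diff:
  assumes "f \<in> H1_per" and "g \<in> H1_per" shows "(\<lambda>s. f s - g s) \<in> H1_per"
  using H1_per_add[OF assms(1) H1_per_scaleR[OF assms(2), of "-1"]] by simp

text \<open>
  The du Bois-Reymond argument. Integration by parts turns the weak derivative condition into
  \<open>\<integral> \<phi>' (f - G) = 0\<close>, where \<open>G\<close> is the primitive of \<open>g\<close>, for all periodic \<open>\<phi>\<close>. The admissible \<open>\<phi>'\<close>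
  are all continuous periodic functions with zero mean, and so each component of \<open>f - G\<close>, reduced by
  its mean, may itself be taken as \<open>\<phi>'\<close>.
\<close>
lemma H1_per_eq_primitive:
  assumes f: "f \<in> H1_per" and g: "g \<in> L2_per" and w: "is_weak_deriv f g" and x: "x \<in> {0..2*pi}"
  shows "f x = f 0 + (LINT s:{0..x}|lborel. g s)"
proof -
  define G where "G x = (LINT s:{0..x}|lborel. g s)" for x
  have gi: "set_integrable lborel {0..2*pi} g" by (rule L2_per_set_integrable[OF g])
  have fper: "periodic_fun_simple f (2*pi)" and fc: "continuous_on UNIV f"
    using f by (auto simp: H1_per_def)
  have Gc: "continuous_on {0..2*pi} G"
  proof (rule continuous_on_eq)
    show "continuous_on {0..2*pi} (\<lambda>x. integral {0..x} g)"
      by (rule indefinite_integral_continuous_1[OF set_borel_integral_eq_integral(1)[OF gi]])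
    fix x assume "x \<in> {0..2*pi}"
    then show "integral {0..x} g = G x"
      unfolding G_def
      by (subst set_borel_integral_eq_integral(2)) (auto intro: set_integrable_subset[OF gi])
  qed
  have G2pi: "G (2*pi) = 0"
    using w[unfolded is_weak_deriv_def, rule_format, of "\<lambda>_. 1" "\<lambda>_. 0"]
    by (simp add: G_def periodic_fun_simple_def)
  have G0: "G 0 = 0"
  proof -
    have "AE s in lborel. indicator {0..0} s *\<^sub>R g s = 0"
      using AE_lborel_singleton[of "0::real"] by eventually_elim (simp add: indicator_def)
    then show ?thesis
      unfolding G_def set_lebesgue_integral_def by (rule integral_eq_zero_AE)
  qed
  have "continuous_on {0..2*pi} (\<lambda>x. f x - G x)"
    by (intro continuous_intros Gc continuous_on_subset[OF fc]) auto
  moreover have "f 0 - G 0 = f (2*pi) - G (2*pi)"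
    using fper G0 G2pi unfolding periodic_fun_simple_def by (metis add_0)
  ultimately obtain H where H: "periodic_fun_simple H (2*pi)" "continuous_on UNIV H"
      "\<And>s. s \<in> {0..2*pi} \<Longrightarrow> H s = f s - G s"
    using periodic_extension_continuous[of "2*pi" "\<lambda>x. f x - G x"] by auto
  have "(f x - G x) $ i = (f 0 - G 0) $ i" for i
  proof -
    define c where "c = (LINT s:{0..2*pi}|lborel. H s $ i) / (2*pi)"
    define q where "q s = H s $ i - c" for s
    have Hi: "set_integrable lborel {0..2*pi} (\<lambda>s. H s $ i)"
      by (intro borel_integrable_atLeastAtMost' continuous_intros continuous_on_subset[OF H(2)]) auto
    have const: "set_integrable lborel {0..2*pi} (\<lambda>s. k)" for k :: real
      by (intro borel_integrable_atLeastAtMost' continuous_intros)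
    have qc: "continuous_on A q" for A
      unfolding q_def by (intro continuous_intros continuous_on_subset[OF H(2)]) auto
    have mean: "(LINT s:{0..2*pi}|lborel. q s) = 0"
      unfolding q_def using set_integral_diff(2)[OF Hi const]
      by (simp add: c_def set_lebesgue_integral_def)
    have "periodic_fun_simple q (2*pi)"
      using H(1) by (simp add: q_def periodic_fun_simple_def)
    then obtain \<phi> where \<phi>: "periodic_fun_simple \<phi> (2*pi)" "\<And>s. (\<phi> has_real_derivative q s) (at s)"
      using periodic_primitive_exists[of q "2*pi"] qc mean by auto
    \<comment> \<open>Compare the weak derivative condition with integration by parts for the primitive of \<open>g\<close>; its boundary term drops out since \<open>G\<close> vanishes at both ends.\<close>
    have 1: "(LINT s:{0..2*pi}|lborel. q s *\<^sub>R f s) = - (LINT s:{0..2*pi}|lborel. \<phi> s *\<^sub>R g s)"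
      using w \<phi> qc[of UNIV] unfolding is_weak_deriv_def by blast
    have 2: "(LINT s:{0..2*pi}|lborel. \<phi> s *\<^sub>R g s) = - (LINT s:{0..2*pi}|lborel. q s *\<^sub>R G s)"
      using integral_by_parts_primitive[OF _ gi \<phi>(2) qc] G2pi by (simp add: G_def)
    have qf: "set_integrable lborel {0..2*pi} (\<lambda>s. q s *\<^sub>R f s)"
      by (intro borel_integrable_atLeastAtMost' continuous_intros qc continuous_on_subset[OF fc]) auto
    have qG: "set_integrable lborel {0..2*pi} (\<lambda>s. q s *\<^sub>R G s)"
      by (intro borel_integrable_atLeastAtMost' continuous_intros qc Gc)
    have qH: "set_integrable lborel {0..2*pi} (\<lambda>s. q s *\<^sub>R H s)"
      by (intro borel_integrable_atLeastAtMost' continuous_intros qc continuous_on_subset[OF H(2)]) auto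
    have "(LINT s:{0..2*pi}|lborel. q s *\<^sub>R H s) = (LINT s:{0..2*pi}|lborel. q s *\<^sub>R f s - q s *\<^sub>R G s)"
      by (intro set_lebesgue_integral_cong) (auto simp: H(3) scaleR_diff_right)
    also have "\<dots> = 0"
      using 1 2 by (simp add: set_integral_diff(2)[OF qf qG])
    finally have "(LINT s:{0..2*pi}|lborel. q s * (H s $ i)) = 0"
      using set_integral_vec_nth(2)[OF qH, of i] by simp
    moreover have "(LINT s:{0..2*pi}|lborel. q s * c) = 0"
      using mean by simp
    moreover have "set_integrable lborel {0..2*pi} (\<lambda>s. q s * (H s $ i))" "set_integrable lborel {0..2*pi} (\<lambda>s. q s * c)"
      by (intro borel_integrable_atLeastAtMost' continuous_intros qc continuous_on_subset[OF H(2)]; simp)+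
    ultimately have "(LINT s:{0..2*pi}|lborel. (q s)\<^sup>2) = 0"
      using set_integral_diff(2)[of lborel "{0..2*pi}" "\<lambda>s. q s * (H s $ i)" "\<lambda>s. q s * c"]
      by (simp add: q_def power2_eq_square algebra_simps)
    moreover have "set_integrable lborel {0..2*pi} (\<lambda>s. (q s)\<^sup>2)"
      by (intro borel_integrable_atLeastAtMost' continuous_intros qc)
    ultimately have "((\<lambda>s. (q s)\<^sup>2) has_integral 0) (cbox 0 (2*pi))"
      using set_borel_integral_eq_integral[of "{0..2*pi}" "\<lambda>s. (q s)\<^sup>2"]
      by (metis box_real(2) integrable_integral)
    then have "(q s)\<^sup>2 = 0" if "s \<in> {0..2*pi}" for s
      using that pi_gt_zero
      by (intro has_integral_0_cbox_imp_0[of 0 "2*pi" "\<lambda>s. (q s)\<^sup>2"]) (auto intro!: continuous_intros qc simp del: pi_gt_zero)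
    then have "q s = 0" if "s \<in> {0..2*pi}" for s
      using that by simp
    from this[of x] this[of 0] x show ?thesis
      by (simp add: q_def H(3))
  qed
  then have "f x - G x = f 0 - G 0" by (simp add: vec_eq_iff)
  then show ?thesis using G0 by (simp add: G_def algebra_simps)
qed

lemma weak_deriv_unique_AE:
  assumes f: "f \<in> H1_per" and "g \<in> L2_per" "h \<in> L2_per" and "is_weak_deriv f g" "is_weak_deriv f h"
  shows "AE s in lborel. s \<in> {0..2*pi} \<longrightarrow> g s = h s"
proof -
  have i: "set_integrable lborel {0..x} k" if "k \<in> L2_per" "x \<in> {0..2*pi}" for x k
    using that by (intro set_integrable_subset[OF L2_per_set_integrable]) auto
  have "AE s in lborel. s \<in> {0..2*pi} \<longrightarrow> g s - h s = 0"
  proof (rule AE_zero_if_primitive_zero)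
    fix x assume x: "x \<in> {0..2*pi}"
    show "(LINT s:{0..x}|lborel. g s - h s) = 0"
      using H1_per_eq_primitive[OF f assms(2) assms(4) x] H1_per_eq_primitive[OF f assms(3) assms(5) x]
      by (simp add: set_integral_diff(2)[OF i[OF assms(2) x] i[OF assms(3) x]])
  qed (auto intro: set_integral_diff L2_per_set_integrable assms)
  then show ?thesis by simp
qed

lemma weak_deriv_H1_per:
  assumes "f \<in> H1_per"
  shows "weak_deriv f \<in> L2_per" and "is_weak_deriv f (weak_deriv f)"
proof -
  have "\<exists>g. g \<in> L2_per \<and> is_weak_deriv f g"
    using assms by (auto simp: H1_per_def)
  from someI_ex[OF this] show "weak_deriv f \<in> L2_per" "is_weak_deriv f (weak_deriv f)"
    by (simp_all add: weak_deriv_def)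
qed

lemma L2_per_norm_set_integrable:
  "g \<in> L2_per \<Longrightarrow> set_integrable lborel {0..2*pi} (\<lambda>s. (norm (g s))\<^sup>2)"
  by (simp add: L2_per_def)

text \<open>
  Since \<open>weak_deriv\<close> is an arbitrary choice among almost everywhere equal functions, this lemma and
  the next two allow \<open>H1_norm\<close> and \<open>lagr\<close> to be computed from any weak derivative at hand.
\<close>
lemma integral_norm_weak_deriv_unique:
  assumes "f \<in> H1_per" and "g \<in> L2_per" and "is_weak_deriv f g"
  shows "(LINT s:{0..2*pi}|lborel. (norm (weak_deriv f s))\<^sup>2) = (LINT s:{0..2*pi}|lborel. (norm (g s))\<^sup>2)"
proof (rule set_lebesgue_integral_cong_AE)
  show "AE s\<in>{0..2*pi} in lborel. (norm (weak_deriv f s))\<^sup>2 = (norm (g s))\<^sup>2"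
    using weak_deriv_unique_AE[OF assms(1) weak_deriv_H1_per(1)[OF assms(1)] assms(2)
        weak_deriv_H1_per(2)[OF assms(1)] assms(3)]
    by eventually_elim simp
qed (use assms weak_deriv_H1_per(1)[OF assms(1), THEN L2_per_measurable] assms(2)[THEN L2_per_measurable] in simp_all)

lemma H1_norm_squared:
  assumes "f \<in> H1_per" and "g \<in> L2_per" and "is_weak_deriv f g"
  shows "(H1_norm f)\<^sup>2 = (LINT s:{0..2*pi}|lborel. (norm (f s))\<^sup>2) + (LINT s:{0..2*pi}|lborel. (norm (g s))\<^sup>2)"
proof -
  have "(LINT s:{0..2*pi}|lborel. (norm (f s))\<^sup>2 + (norm (weak_deriv f s))\<^sup>2) \<ge> 0"
    unfolding set_lebesgue_integral_def by (intro integral_nonneg_AE AE_I2) simp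
  then show ?thesis
    using integral_norm_weak_deriv_unique[OF assms]
    by (simp add: H1_norm_def set_integral_add(2) L2_per_norm_set_integrable
        H1_per_in_L2_per weak_deriv_H1_per assms(1))
qed

lemma lagr_eq:
  assumes "f \<in> H1_per" and "g \<in> L2_per" and "is_weak_deriv f g"
  shows "lagr f = ((LINT s:{0..2*pi}|lborel. (norm (g s))\<^sup>2) - (LINT s:{0..2*pi}|lborel. (norm (f s))\<^sup>2)) / 2"
  using integral_norm_weak_deriv_unique[OF assms]
  by (simp add: lagr_def set_integral_diff(2) L2_per_norm_set_integrable
      H1_per_in_L2_per weak_deriv_H1_per assms(1))

lemma H1_norm_nonneg: "H1_norm f \<ge> 0"
  unfolding H1_norm_def set_lebesgue_integral_def
  by (intro real_sqrt_ge_zero integral_nonneg_AE AE_I2) simp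

lemma L2_sq_integral_nonneg: "(LINT s:{0..2*pi}|lborel. (norm (g s))\<^sup>2) \<ge> 0"
  unfolding set_lebesgue_integral_def by (intro integral_nonneg_AE AE_I2) simp

lemma abs_lagr_le:
  assumes "f \<in> H1_per"
  shows "\<bar>lagr f\<bar> \<le> (H1_norm f)\<^sup>2 / 2"
  using lagr_eq[OF assms weak_deriv_H1_per[OF assms]] H1_norm_squared[OF assms weak_deriv_H1_per[OF assms]]
    L2_sq_integral_nonneg[of f] L2_sq_integral_nonneg[of "weak_deriv f"]
  by (simp add: abs_le_iff)

text \<open>
  This weak form of the triangle inequality follows from the parallelogram law and suffices to see that
  the increments in question stay bounded in \<open>H1_norm\<close>.
\<close>
lemma H1_norm_squared_add_le:
  assumes f: "f \<in> H1_per" and g: "g \<in> H1_per"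
  shows "(H1_norm (\<lambda>s. f s + g s))\<^sup>2 \<le> 2 * (H1_norm f)\<^sup>2 + 2 * (H1_norm g)\<^sup>2"
proof -
  define f' g' where "f' = weak_deriv f" and "g' = weak_deriv g"
  have f': "f' \<in> L2_per" "is_weak_deriv f f'" and g': "g' \<in> L2_per" "is_weak_deriv g g'"
    using f g by (simp_all add: f'_def g'_def weak_deriv_H1_per)
  have le: "(LINT s:{0..2*pi}|lborel. (norm (a s + b s))\<^sup>2) \<le>
      2 * (LINT s:{0..2*pi}|lborel. (norm (a s))\<^sup>2) + 2 * (LINT s:{0..2*pi}|lborel. (norm (b s))\<^sup>2)"
    if "a \<in> L2_per" "b \<in> L2_per" for a b
  proof -
    have "(norm (x + y))\<^sup>2 \<le> 2 * (norm x)\<^sup>2 + 2 * (norm y)\<^sup>2" for x y :: "real^3"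
    proof -
      have "0 \<le> (norm (x - y))\<^sup>2" by simp
      then show ?thesis by (simp add: power2_norm_eq_inner inner_add inner_diff inner_commute)
    qed
    then have "(LINT s:{0..2*pi}|lborel. (norm (a s + b s))\<^sup>2) \<le>
        (LINT s:{0..2*pi}|lborel. 2 * (norm (a s))\<^sup>2 + 2 * (norm (b s))\<^sup>2)"
      using that by (intro set_integral_mono set_integral_add(1))
        (auto simp: L2_per_norm_set_integrable L2_per_norm_set_integrable[OF L2_per_add[OF that]])
    also have "\<dots> = 2 * (LINT s:{0..2*pi}|lborel. (norm (a s))\<^sup>2) + 2 * (LINT s:{0..2*pi}|lborel. (norm (b s))\<^sup>2)"
      using that by (subst set_integral_add(2)) (auto simp: L2_per_norm_set_integrable)
    finally show ?thesis .
  qed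
  have "is_weak_deriv (\<lambda>s. f s + g s) (\<lambda>s. f' s + g' s)"
    by (intro is_weak_deriv_add H1_per_in_L2_per f g f' g')
  from H1_norm_squared[OF H1_per_add[OF f g] L2_per_add[OF f'(1) g'(1)] this]
  show ?thesis
    using le[OF f'(1) g'(1)] le[OF H1_per_in_L2_per[OF f] H1_per_in_L2_per[OF g]]
      H1_norm_squared[OF f f'] H1_norm_squared[OF g g'] by simp
qed

lemma H1_norm_scaleR:
  assumes f: "f \<in> H1_per" shows "H1_norm (\<lambda>s. c *\<^sub>R f s) = \<bar>c\<bar> * H1_norm f"
proof -
  note f' = weak_deriv_H1_per[OF f]
  have "(H1_norm (\<lambda>s. c *\<^sub>R f s))\<^sup>2 = c\<^sup>2 * (H1_norm f)\<^sup>2"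
    using H1_norm_squared[OF H1_per_scaleR[OF f] L2_per_scaleR[OF f'(1)] is_weak_deriv_scaleR[OF f'(2)], of c]
      H1_norm_squared[OF f f']
    by (simp add: power_mult_distrib distrib_left)
  also have "\<dots> = (\<bar>c\<bar> * H1_norm f)\<^sup>2" by (simp add: power_mult_distrib)
  finally show ?thesis
    using H1_norm_nonneg by (simp add: power2_eq_iff_nonneg)
qed

text \<open>
  A substitute for the Cauchy-Schwarz inequality \<open>\<integral> |h| \<le> sqrt (2\<pi>) N\<close>, obtained by integrating
  \<open>|h| \<le> \<delta> / 2 + |h|\<^sup>2 / (2 \<delta>)\<close>. The slack between \<open>N\<close> and \<open>\<delta>\<close> covers the case \<open>N = 0\<close>.
\<close>
lemma integral_norm_le:
  assumes h: "h \<in> L2_per" and "(LINT s:{0..2*pi}|lborel. (norm (h s))\<^sup>2) \<le> N\<^sup>2" and "0 \<le> N" and "N < \<delta>"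
  shows "(LINT s:{0..2*pi}|lborel. norm (h s)) \<le> (pi + 1/2) * \<delta>"
proof -
  have \<delta>: "\<delta> > 0" using assms by simp
  have "norm x \<le> \<delta> / 2 + (norm x)\<^sup>2 / (2 * \<delta>)" for x :: "real^3"
  proof -
    have "0 \<le> (norm x - \<delta>)\<^sup>2" by simp
    then show ?thesis using \<delta> by (simp add: field_simps power2_eq_square)
  qed
  moreover have c: "set_integrable lborel {0..2*pi} (\<lambda>s. \<delta> / 2)"
    by (intro borel_integrable_atLeastAtMost' continuous_intros)
  moreover have i: "set_integrable lborel {0..2*pi} (\<lambda>s. (norm (h s))\<^sup>2 / (2 * \<delta>))"
    using L2_per_norm_set_integrable[OF h] by simp
  ultimately have "(LINT s:{0..2*pi}|lborel. norm (h s)) \<le> (LINT s:{0..2*pi}|lborel. \<delta> / 2 + (norm (h s))\<^sup>2 / (2 * \<delta>))"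
    using set_integrable_norm[OF L2_per_set_integrable[OF h]]
    by (intro set_integral_mono set_integral_add(1)) auto
  also have "\<dots> = pi * \<delta> + (LINT s:{0..2*pi}|lborel. (norm (h s))\<^sup>2) / (2 * \<delta>)"
    by (subst set_integral_add(2)[OF c i]) (simp add: set_lebesgue_integral_def)
  also have "\<dots> \<le> pi * \<delta> + \<delta>\<^sup>2 / (2 * \<delta>)"
    using assms \<delta> by (intro add_left_mono divide_right_mono order_trans[OF assms(2)] power_mono) auto
  also have "\<dots> = (pi + 1/2) * \<delta>" using \<delta> by (simp add: power2_eq_square algebra_simps)
  finally show ?thesis .
qed

text \<open>
  The Sobolev embedding in dimension one: \<open>f x\<close> differs from each \<open>f t\<close> by an integral of the
  derivative, and averaging over \<open>t\<close> replaces \<open>f t\<close> by an integral of \<open>f\<close>.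
\<close>
lemma sup_le_H1_norm:
  "\<exists>C>0. \<forall>f\<in>H1_per. \<forall>x\<in>{0..2*pi}. norm (f x) \<le> C * H1_norm f"
proof (intro exI conjI ballI)
  define C where "C = (pi + 1/2) / (2 * pi) + 2 * (pi + 1/2)"
  show C: "C > 0" by (auto simp: C_def intro!: add_pos_pos divide_pos_pos)
  fix f and x :: real assume f: "f \<in> H1_per" and x: "x \<in> {0..2*pi}"
  define g where "g = weak_deriv f"
  have g: "g \<in> L2_per" "is_weak_deriv f g" using f by (simp_all add: g_def weak_deriv_H1_per)
  have "norm (f x) / C \<le> \<delta>" if \<delta>: "\<delta> > H1_norm f" for \<delta>
  proof -
    have gi: "(LINT s:{0..2*pi}|lborel. norm (g s)) \<le> (pi + 1/2) * \<delta>"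
      using H1_norm_squared[OF f g] L2_sq_integral_nonneg[of f]
      by (intro integral_norm_le[OF g(1) _ H1_norm_nonneg \<delta>]) simp
    have fi: "(LINT s:{0..2*pi}|lborel. norm (f s)) \<le> (pi + 1/2) * \<delta>"
      using H1_norm_squared[OF f g] L2_sq_integral_nonneg[of g]
      by (intro integral_norm_le[OF H1_per_in_L2_per[OF f] _ H1_norm_nonneg \<delta>]) simp
    have G: "norm (LINT s:{0..y}|lborel. g s) \<le> (pi + 1/2) * \<delta>" if "y \<in> {0..2*pi}" for y
    proof -
      have "norm (LINT s:{0..y}|lborel. g s) \<le> (LINT s:{0..y}|lborel. norm (g s))"
        using that by (intro set_integral_norm_bound set_integrable_subset[OF L2_per_set_integrable[OF g(1)]]) auto
      also have "\<dots> \<le> (LINT s:{0..2*pi}|lborel. norm (g s))"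
        unfolding set_lebesgue_integral_def
        using that set_integrable_norm[OF L2_per_set_integrable[OF g(1)]]
          set_integrable_norm[OF set_integrable_subset[OF L2_per_set_integrable[OF g(1)], of "{0..y}"]]
        by (intro integral_mono) (auto simp: set_integrable_def indicator_def)
      finally show ?thesis using gi by simp
    qed
    have "norm (f x) \<le> norm (f t) + 2 * (pi + 1/2) * \<delta>" if t: "t \<in> {0..2*pi}" for t
    proof -
      have "f x = f t + ((LINT s:{0..x}|lborel. g s) - (LINT s:{0..t}|lborel. g s))"
        using H1_per_eq_primitive[OF f g x] H1_per_eq_primitive[OF f g t] by simp
      also have "norm \<dots> \<le> norm (f t) + ((pi + 1/2) * \<delta> + (pi + 1/2) * \<delta>)"
        by (intro order_trans[OF norm_triangle_ineq] add_left_mono order_trans[OF norm_triangle_ineq4] add_mono G x t)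
      finally show ?thesis by (simp add: algebra_simps)
    qed
    moreover have c: "set_integrable lborel {0..2*pi} (\<lambda>s. k)" for k :: real
      by (intro borel_integrable_atLeastAtMost' continuous_intros)
    moreover have nf: "set_integrable lborel {0..2*pi} (\<lambda>s. norm (f s))"
      by (intro set_integrable_norm L2_per_set_integrable H1_per_in_L2_per f)
    ultimately have "(LINT t:{0..2*pi}|lborel. norm (f x)) \<le> (LINT t:{0..2*pi}|lborel. norm (f t) + 2 * (pi + 1/2) * \<delta>)"
      by (intro set_integral_mono set_integral_add(1)) auto
    also have "\<dots> = (LINT t:{0..2*pi}|lborel. norm (f t)) + 2 * pi * (2 * (pi + 1/2) * \<delta>)"
      by (subst set_integral_add(2)[OF nf c]) (simp add: set_lebesgue_integral_def)
    also have "\<dots> \<le> 2 * pi * (C * \<delta>)"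
    proof -
      have "2 * pi * (C * \<delta>) = (pi + 1/2) * \<delta> + 2 * pi * (2 * (pi + 1/2) * \<delta>)"
        by (simp add: C_def field_simps)
      then show ?thesis using fi by simp
    qed
    finally have "2 * pi * norm (f x) \<le> 2 * pi * (C * \<delta>)"
      by (simp add: set_lebesgue_integral_def)
    then have "norm (f x) \<le> C * \<delta>" by simp
    then show ?thesis using C by (simp add: pos_divide_le_eq mult.commute)
  qed
  then have "norm (f x) / C \<le> H1_norm f" by (rule dense_ge)
  then show "norm (f x) \<le> C * H1_norm f" using C by (simp add: pos_divide_le_eq mult.commute)
qed

lemma H1_per_by_parts:
  assumes f: "f \<in> H1_per" and g: "g \<in> L2_per" "is_weak_deriv f g" and x: "x \<in> {0..2*pi}"
    and \<phi>: "\<And>s. (\<phi> has_real_derivative \<phi>' s) (at s)" and \<phi>': "continuous_on UNIV \<phi>'"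
  shows "set_integrable lborel {0..x} (\<lambda>s. \<phi> s *\<^sub>R g s + \<phi>' s *\<^sub>R f s)"
    and "(LINT s:{0..x}|lborel. \<phi> s *\<^sub>R g s + \<phi>' s *\<^sub>R f s) = \<phi> x *\<^sub>R f x - \<phi> 0 *\<^sub>R f 0"
proof -
  have fc: "continuous_on A f" and \<phi>'c: "continuous_on A \<phi>'" for A
    using f \<phi>' by (auto simp: H1_per_def intro: continuous_on_subset)
  have \<phi>c: "continuous_on A \<phi>" for A
    using \<phi> by (meson DERIV_isCont continuous_at_imp_continuous_on)
  have gi: "set_integrable lborel {0..x} g"
    using x by (intro set_integrable_subset[OF L2_per_set_integrable[OF g(1)]]) auto
  have i1: "set_integrable lborel {0..x} (\<lambda>s. \<phi> s *\<^sub>R g s)"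
    by (rule set_integrable_continuous_scaleR[OF \<phi>c gi])
  have i2: "set_integrable lborel {0..x} (\<lambda>s. \<phi>' s *\<^sub>R f s)"
    and i3: "set_integrable lborel {0..x} (\<lambda>s. \<phi>' s *\<^sub>R f 0)" 
    by (intro borel_integrable_atLeastAtMost' continuous_intros fc \<phi>'c)+
  show "set_integrable lborel {0..x} (\<lambda>s. \<phi> s *\<^sub>R g s + \<phi>' s *\<^sub>R f s)"
    using i1 i2 by simp
  have "(LINT t:{0..x}|lborel. \<phi>' t *\<^sub>R (LINT s:{0..t}|lborel. g s)) = (LINT t:{0..x}|lborel. \<phi>' t *\<^sub>R f t - \<phi>' t *\<^sub>R f 0)"
  proof (rule set_lebesgue_integral_cong)
    show "\<forall>t. t \<in> {0..x} \<longrightarrow> \<phi>' t *\<^sub>R (LINT s:{0..t}|lborel. g s) = \<phi>' t *\<^sub>R f t - \<phi>' t *\<^sub>R f 0"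
    proof (intro allI impI)
      fix t assume "t \<in> {0..x}"
      then have "f t = f 0 + (LINT s:{0..t}|lborel. g s)"
        using x by (intro H1_per_eq_primitive f g) auto
      then show "\<phi>' t *\<^sub>R (LINT s:{0..t}|lborel. g s) = \<phi>' t *\<^sub>R f t - \<phi>' t *\<^sub>R f 0"
        by (simp add: algebra_simps)
    qed
  qed simp
  also have "\<dots> = (LINT t:{0..x}|lborel. \<phi>' t *\<^sub>R f t) - (LINT t:{0..x}|lborel. \<phi>' t) *\<^sub>R f 0"
    unfolding set_integral_diff(2)[OF i2 i3]
    by (simp only: set_integral_scaleR_const[OF borel_integrable_atLeastAtMost'[OF \<phi>'c]])
  also have "(LINT t:{0..x}|lborel. \<phi>' t) = \<phi> x - \<phi> 0"
    using x by (intro set_integral_FTC_real \<phi> \<phi>') auto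
  finally have "(LINT s:{0..x}|lborel. \<phi> s *\<^sub>R g s) = \<phi> x *\<^sub>R (LINT s:{0..x}|lborel. g s)
      - ((LINT t:{0..x}|lborel. \<phi>' t *\<^sub>R f t) - (\<phi> x - \<phi> 0) *\<^sub>R f 0)"
    using integral_by_parts_primitive[OF _ gi \<phi> \<phi>'] x by simp
  then show "(LINT s:{0..x}|lborel. \<phi> s *\<^sub>R g s + \<phi>' s *\<^sub>R f s) = \<phi> x *\<^sub>R f x - \<phi> 0 *\<^sub>R f 0"
    unfolding set_integral_add(2)[OF i1 i2] H1_per_eq_primitive[OF f g x] by (simp add: algebra_simps)
qed

section \<open>The broken cosine and the expansion of the functional\<close>

text \<open>
  This form makes continuity evident and evaluates the function at any argument without reduction
  modulo the period.
\<close>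
lemma cos_ab_eq: "cos_ab \<alpha> \<beta> s = \<alpha> * max 0 (cos s) + \<beta> * min 0 (cos s)"
proof -
  define t where "t = (s + pi/2) rmod (2*pi) - pi/2"
  have "cos t = sin ((s + pi/2) rmod (2*pi))"
    by (simp add: t_def cos_diff)
  then have c: "cos t = cos s"
    by (simp add: sin_add)
  have t: "-pi/2 \<le> t" "t < 3*pi/2"
    using rmod_nonneg[of "2*pi" "s + pi/2"] rmod_less[of "2*pi" "s + pi/2"] by (simp_all add: t_def)
  show ?thesis
  proof (cases "t \<le> pi/2")
    case True
    then have "0 \<le> cos t" using t by (intro cos_ge_zero) auto
    then show ?thesis using True c by (simp add: cos_ab_def t_def[symmetric] Let_def)
  next
    case False
    have "cos (t - pi) \<ge> 0" using t False by (intro cos_ge_zero) auto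
    then have "cos t \<le> 0" by (simp add: cos_diff)
    then show ?thesis using False c by (simp add: cos_ab_def t_def[symmetric] Let_def)
  qed
qed

lemma X0_eq: "X0 \<alpha> \<beta> s = cos_ab \<alpha> \<beta> s *\<^sub>R axis 1 1"
  by (simp add: X0_def vec_eq_iff forall_3 axis_def)

lemma cos_pos_iff_period:
  assumes "s \<in> {0..2*pi}"
  shows "cos s > 0 \<longleftrightarrow> s \<notin> {pi/2..3*pi/2}"
proof -
  consider "s < pi/2" | "s \<in> {pi/2..3*pi/2}" | "s > 3*pi/2" by force
  then show ?thesis
  proof cases
    case 1
    then have "cos s > 0" using assms by (intro cos_gt_zero_pi) auto
    then show ?thesis using 1 by simp
  next
    case 2
    then have "cos (s - pi) \<ge> 0" by (intro cos_ge_zero) auto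
    then have "cos s \<le> 0" by (simp add: cos_diff)
    then show ?thesis using 2 by simp
  next
    case 3
    then have "cos (s - 2*pi) > 0" using assms by (intro cos_gt_zero_pi) auto
    then show ?thesis using 3 by (simp add: cos_diff)
  qed
qed

text \<open>
  At the corners, where the cosine vanishes, the value is arbitrary. Choosing the slope \<open>\<beta>\<close> there makes
  \<open>slope_on_period\<close> an identity on the whole closed period instead of one up to two points.
\<close>
definition X0_deriv :: "real \<Rightarrow> real \<Rightarrow> real \<Rightarrow> real^3" where
  "X0_deriv \<alpha> \<beta> s = (- (if cos s > 0 then \<alpha> else \<beta>) * sin s) *\<^sub>R axis 1 1"

text \<open>
  The broken cosine is a smooth periodic function plus a multiple of the cosine cut off to the inner
  half period. Integration by parts on the whole period has no boundary terms, and so all corner terms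
  come from the cut-off part.
\<close>
lemma cos_ab_on_period:
  assumes "s \<in> {0..2*pi}"
  shows "cos_ab \<alpha> \<beta> s = \<alpha> * cos s + (\<beta> - \<alpha>) * (indicator {pi/2..3*pi/2} s * cos s)"
  using cos_pos_iff_period[OF assms] by (auto simp: cos_ab_eq indicator_def max_def min_def algebra_simps)

lemma slope_on_period:
  assumes "s \<in> {0..2*pi}"
  shows "- (if cos s > 0 then \<alpha> else \<beta>) * sin s = - \<alpha> * sin s - (\<beta> - \<alpha>) * (indicator {pi/2..3*pi/2} s * sin s)"
  using cos_pos_iff_period[OF assms] by (auto simp: indicator_def algebra_simps)

lemma continuous_on_cos_ab: "continuous_on A (cos_ab \<alpha> \<beta>)"
  unfolding cos_ab_eq[abs_def] by (intro continuous_intros)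

lemma set_integral_indicator_times:
  fixes k :: "real \<Rightarrow> real"
  assumes "J \<subseteq> A"
  shows "(LINT s:A|M. indicator J s * k s) = (LINT s:J|M. k s)"
proof -
  have "(\<lambda>s. indicator A s *\<^sub>R (indicator J s * k s)) = (\<lambda>s. indicator J s *\<^sub>R k s)"
    using assms by (auto simp: fun_eq_iff indicator_def)
  then show ?thesis by (simp add: set_lebesgue_integral_def)
qed

lemma set_integral_broken:
  fixes k :: "real \<Rightarrow> real"
  assumes k: "set_integrable lborel {0..2*pi} k"
  shows "set_integrable lborel {0..2*pi} (\<lambda>s. a * k s + b * (indicator {pi/2..3*pi/2} s * k s))"
    and "(LINT s:{0..2*pi}|lborel. a * k s + b * (indicator {pi/2..3*pi/2} s * k s)) =
      a * (LINT s:{0..2*pi}|lborel. k s) + b * (LINT s:{pi/2..3*pi/2}|lborel. k s)"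
proof -
  have "set_integrable lborel {pi/2..3*pi/2} k"
    by (rule set_integrable_subset[OF k]) auto
  moreover have "(\<lambda>s. indicator {0..2*pi} s *\<^sub>R (indicator {pi/2..3*pi/2} s * k s)) = (\<lambda>s. indicator {pi/2..3*pi/2} s *\<^sub>R k s)"
    by (auto simp: indicator_def)
  ultimately have i: "set_integrable lborel {0..2*pi} (\<lambda>s. indicator {pi/2..3*pi/2} s * k s)"
    by (simp add: set_integrable_def)
  show "set_integrable lborel {0..2*pi} (\<lambda>s. a * k s + b * (indicator {pi/2..3*pi/2} s * k s))"
    using k i by (intro set_integral_add(1)) auto
  show "(LINT s:{0..2*pi}|lborel. a * k s + b * (indicator {pi/2..3*pi/2} s * k s)) =
      a * (LINT s:{0..2*pi}|lborel. k s) + b * (LINT s:{pi/2..3*pi/2}|lborel. k s)"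
    using k i by (subst set_integral_add(2)) (auto simp: set_integral_indicator_times)
qed

lemma cos_3pi_half: "cos (3*pi/2) = 0" and sin_3pi_half: "sin (3*pi/2) = -1"
  using cos_3over2_pi sin_3over2_pi by (simp_all add: field_simps)

lemma X0_deriv_L2: "X0_deriv \<alpha> \<beta> \<in> L2_per"
proof -
  have "(\<lambda>s. X0_deriv \<alpha> \<beta> s) \<in> borel_measurable borel"
    unfolding X0_deriv_def by measurable
  moreover have "set_integrable lborel {0..2*pi} (\<lambda>s. (norm (X0_deriv \<alpha> \<beta> s))\<^sup>2)"
  proof -
    have "set_integrable lborel {0..2*pi} (\<lambda>s. \<alpha>\<^sup>2 * (sin s)\<^sup>2 + (\<beta>\<^sup>2 - \<alpha>\<^sup>2) * (indicator {pi/2..3*pi/2} s * (sin s)\<^sup>2))"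
      by (intro set_integral_broken borel_integrable_atLeastAtMost' continuous_intros)
    then show ?thesis
    proof (rule set_integrable_cong[THEN iffD1, rotated -1])
      fix s :: real assume "s \<in> {0..2*pi}"
      then show "\<alpha>\<^sup>2 * (sin s)\<^sup>2 + (\<beta>\<^sup>2 - \<alpha>\<^sup>2) * (indicator {pi/2..3*pi/2} s * (sin s)\<^sup>2) = (norm (X0_deriv \<alpha> \<beta> s))\<^sup>2"
        using cos_pos_iff_period[of s] by (auto simp: X0_deriv_def indicator_def power_mult_distrib algebra_simps)
    qed auto
  qed
  moreover have "periodic_fun_simple (X0_deriv \<alpha> \<beta>) (2*pi)"
    by unfold_locales (simp add: X0_deriv_def)
  ultimately show ?thesis by (simp add: L2_per_def)
qed

text \<open>
  No corner terms appear here, because \<open>\<phi> s * cos s\<close> vanishes at \<open>\<pi>/2\<close> and \<open>3\<pi>/2\<close>.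
\<close>
lemma X0_is_weak_deriv: "is_weak_deriv (X0 \<alpha> \<beta>) (X0_deriv \<alpha> \<beta>)"
  unfolding is_weak_deriv_def
proof (intro allI impI; elim conjE)
  fix \<phi> \<phi>' :: "real \<Rightarrow> real"
  assume per: "periodic_fun_simple \<phi> (2*pi)" and d: "\<forall>s. (\<phi> has_real_derivative \<phi>' s) (at s)"
    and c': "continuous_on UNIV \<phi>'"
  define k where "k s = \<phi>' s * cos s - \<phi> s * sin s" for s
  have c: "continuous_on A \<phi>'" "continuous_on A \<phi>" for A
    using c' d by (auto intro: continuous_on_subset DERIV_isCont continuous_at_imp_continuous_on)
  have dk: "((\<lambda>s. \<phi> s * cos s) has_real_derivative k s) (at s)" for s
    unfolding k_def using d by (auto intro!: derivative_eq_intros)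
  have kc: "continuous_on A k" for A
    unfolding k_def by (intro continuous_intros c)
  have k: "(LINT s:{0..2*pi}|lborel. k s) = 0" "(LINT s:{pi/2..3*pi/2}|lborel. k s) = 0"
    using per set_integral_FTC_real[OF _ dk kc, of 0 "2*pi"] set_integral_FTC_real[OF _ dk kc, of "pi/2" "3*pi/2"]
    by (auto simp: periodic_fun_simple_def cos_3pi_half dest: spec[of _ 0])
  have ki: "set_integrable lborel {0..2*pi} k"
    by (intro borel_integrable_atLeastAtMost' kc)
  define e :: "real^3" where "e = axis 1 1"
  have i1: "set_integrable lborel {0..2*pi} (\<lambda>s. \<phi>' s *\<^sub>R X0 \<alpha> \<beta> s)"
    unfolding X0_eq by (intro borel_integrable_atLeastAtMost' continuous_intros c continuous_on_cos_ab)
  have i2: "set_integrable lborel {0..2*pi} (\<lambda>s. \<phi> s *\<^sub>R X0_deriv \<alpha> \<beta> s)"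
    by (intro set_integrable_continuous_scaleR c L2_per_set_integrable X0_deriv_L2)
  have "(LINT s:{0..2*pi}|lborel. \<phi>' s *\<^sub>R X0 \<alpha> \<beta> s) + (LINT s:{0..2*pi}|lborel. \<phi> s *\<^sub>R X0_deriv \<alpha> \<beta> s) =
      (LINT s:{0..2*pi}|lborel. (\<alpha> * k s + (\<beta> - \<alpha>) * (indicator {pi/2..3*pi/2} s * k s)) *\<^sub>R e)"
    unfolding set_integral_add(2)[OF i1 i2, symmetric]
  proof (intro set_lebesgue_integral_cong allI impI)
    fix s :: real assume s: "s \<in> {0..2*pi}"
    show "\<phi>' s *\<^sub>R X0 \<alpha> \<beta> s + \<phi> s *\<^sub>R X0_deriv \<alpha> \<beta> s = (\<alpha> * k s + (\<beta> - \<alpha>) * (indicator {pi/2..3*pi/2} s * k s)) *\<^sub>R e"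
      unfolding X0_eq X0_deriv_def slope_on_period[OF s] cos_ab_on_period[OF s] e_def[symmetric] k_def
      by (simp add: algebra_simps flip: scaleR_add_left scaleR_diff_left)
  qed simp
  also have "\<dots> = (LINT s:{0..2*pi}|lborel. \<alpha> * k s + (\<beta> - \<alpha>) * (indicator {pi/2..3*pi/2} s * k s)) *\<^sub>R e"
    by (rule set_integral_scaleR_const) (rule set_integral_broken(1)[OF ki])
  also have "\<dots> = 0"
    unfolding set_integral_broken(2)[OF ki] k by simp
  finally show "(LINT s:{0..2*pi}|lborel. \<phi>' s *\<^sub>R X0 \<alpha> \<beta> s) = - (LINT s:{0..2*pi}|lborel. \<phi> s *\<^sub>R X0_deriv \<alpha> \<beta> s)"
    by (simp add: eq_neg_iff_add_eq_0)
qed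

lemma continuous_on_X0: "continuous_on A (X0 \<alpha> \<beta>)"
  unfolding X0_eq[abs_def] by (intro continuous_intros continuous_on_cos_ab)

lemma X0_H1_per: "X0 \<alpha> \<beta> \<in> H1_per"
proof -
  have "periodic_fun_simple (X0 \<alpha> \<beta>) (2*pi)"
    using cos_ab_periodic[of \<alpha> \<beta>] by (simp add: periodic_fun_simple_def X0_eq)
  then show ?thesis
    using continuous_on_X0 X0_deriv_L2[of \<alpha> \<beta>] X0_is_weak_deriv[of \<alpha> \<beta>] by (auto simp: H1_per_def)
qed

lemma set_integral_combine:
  fixes k :: "real \<Rightarrow> real"
  assumes "a \<le> m" "m \<le> b" and k: "set_integrable lborel {a..b} k"
  shows "(LINT s:{a..b}|lborel. k s) = (LINT s:{a..m}|lborel. k s) + (LINT s:{m..b}|lborel. k s)"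
proof -
  have i: "set_integrable lborel {a..m} k" "set_integrable lborel {m..b} k"
    using assms by (auto intro: set_integrable_subset[OF k])
  show ?thesis
    using Henstock_Kurzweil_Integration.integral_combine[OF assms(1,2) set_borel_integral_eq_integral(1)[OF k]]
    by (simp add: set_borel_integral_eq_integral(2) k i)
qed

text \<open>
  The mixed term is \<open>\<integral> X\<^sub>0' \<bullet> h' - X\<^sub>0 \<bullet> h\<close>. Its integrand is a combination of \<open>(sin s * h\<^sub>1 s)'\<close> on the
  whole period, which integrates to zero, and on the inner half period, where \<open>sin\<close> takes the values
  \<open>1\<close> and \<open>-1\<close> at the end points.
\<close>
lemma lagr_X0_plus:
  assumes h: "h \<in> H1_per"
  shows "lagr (\<lambda>s. X0 \<alpha> \<beta> s + h s) =
    lagr (X0 \<alpha> \<beta>) - (\<alpha> - \<beta>) * (h (pi/2) + h (3*pi/2)) $ 1 + lagr h"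
proof -
  define g where "g = weak_deriv h"
  have g: "g \<in> L2_per" "is_weak_deriv h g" using h by (simp_all add: g_def weak_deriv_H1_per)
  note X0 = X0_H1_per[of \<alpha> \<beta>] X0_deriv_L2[of \<alpha> \<beta>] X0_is_weak_deriv[of \<alpha> \<beta>]
  have expand: "(LINT s:{0..2*pi}|lborel. (norm (u s + v s))\<^sup>2) =
      (LINT s:{0..2*pi}|lborel. (norm (u s))\<^sup>2) + (LINT s:{0..2*pi}|lborel. (norm (v s))\<^sup>2)
      + 2 * (LINT s:{0..2*pi}|lborel. u s \<bullet> v s)" if "u \<in> L2_per" "v \<in> L2_per" for u v
  proof -
    have "(\<lambda>s. (norm (u s + v s))\<^sup>2) = (\<lambda>s. ((norm (u s))\<^sup>2 + (norm (v s))\<^sup>2) + 2 * (u s \<bullet> v s))"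
      by (simp add: power2_norm_eq_inner inner_add inner_commute algebra_simps)
    then show ?thesis
      using that L2_per_inner_set_integrable[OF that]
      by (simp add: set_integral_add L2_per_norm_set_integrable)
  qed
  define k where "k s = sin s * g s $ 1 + cos s * h s $ 1" for s
  have "set_integrable lborel {0..x} k \<and> (LINT s:{0..x}|lborel. k s) = sin x * h x $ 1" if x: "x \<in> {0..2*pi}" for x
  proof -
    have "continuous_on UNIV (cos :: real \<Rightarrow> real)" by (intro continuous_intros)
    note p = H1_per_by_parts[OF h g x DERIV_sin this]
    show ?thesis
      using p(2) set_integral_vec_nth[OF p(1), of 1] by (simp add: k_def[abs_def])
  qed
  note k = this[THEN conjunct1] this[THEN conjunct2]
  have "(LINT s:{0..3*pi/2}|lborel. k s) = (LINT s:{0..pi/2}|lborel. k s) + (LINT s:{pi/2..3*pi/2}|lborel. k s)"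
    using k(1)[of "3*pi/2"] by (intro set_integral_combine) auto
  then have kJ: "(LINT s:{pi/2..3*pi/2}|lborel. k s) = - (h (pi/2) + h (3*pi/2)) $ 1"
    using k(2)[of "3*pi/2"] k(2)[of "pi/2"] by (simp add: sin_3pi_half)
  have k2: "(LINT s:{0..2*pi}|lborel. k s) = 0"
    using k(2)[of "2*pi"] by simp
  have "(LINT s:{0..2*pi}|lborel. X0_deriv \<alpha> \<beta> s \<bullet> g s) - (LINT s:{0..2*pi}|lborel. X0 \<alpha> \<beta> s \<bullet> h s) =
      (LINT s:{0..2*pi}|lborel. X0_deriv \<alpha> \<beta> s \<bullet> g s - X0 \<alpha> \<beta> s \<bullet> h s)"
    by (intro set_integral_diff(2)[symmetric] L2_per_inner_set_integrable X0 g H1_per_in_L2_per h)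
  also have "\<dots> = (LINT s:{0..2*pi}|lborel. - \<alpha> * k s + (\<alpha> - \<beta>) * (indicator {pi/2..3*pi/2} s * k s))"
  proof (intro set_lebesgue_integral_cong allI impI)
    fix s :: real assume s: "s \<in> {0..2*pi}"
    show "X0_deriv \<alpha> \<beta> s \<bullet> g s - X0 \<alpha> \<beta> s \<bullet> h s = - \<alpha> * k s + (\<alpha> - \<beta>) * (indicator {pi/2..3*pi/2} s * k s)"
      unfolding X0_eq X0_deriv_def slope_on_period[OF s] cos_ab_on_period[OF s] k_def
      by (simp add: inner_axis' algebra_simps)
  qed simp
  also have "\<dots> = - (\<alpha> - \<beta>) * (h (pi/2) + h (3*pi/2)) $ 1"
    unfolding set_integral_broken(2)[OF k(1)[of "2*pi", simplified]] kJ k2 by (simp add: algebra_simps)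
  finally have cross: "(LINT s:{0..2*pi}|lborel. X0_deriv \<alpha> \<beta> s \<bullet> g s) - (LINT s:{0..2*pi}|lborel. X0 \<alpha> \<beta> s \<bullet> h s)
      = - (\<alpha> - \<beta>) * (h (pi/2) + h (3*pi/2)) $ 1" .
  have "is_weak_deriv (\<lambda>s. X0 \<alpha> \<beta> s + h s) (\<lambda>s. X0_deriv \<alpha> \<beta> s + g s)"
    by (intro is_weak_deriv_add X0 g H1_per_in_L2_per h)
  from lagr_eq[OF H1_per_add[OF X0(1) h] L2_per_add[OF X0(2) g(1)] this]
  show ?thesis
    using cross expand[OF X0(2) g(1)] expand[OF H1_per_in_L2_per[OF X0(1)] H1_per_in_L2_per[OF h]]
      lagr_eq[OF X0] lagr_eq[OF h g] by (simp add: field_simps)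
qed

section \<open>Blow-up of the direction field at a zero\<close>

text \<open>
  The cosine of the angle between \<open>x\<close> and \<open>e\<close> differs from \<open>1\<close> only quadratically in the transversal part
  of \<open>x\<close>. This is what makes the first-order effect concentrate near the zeros.
\<close>
lemma one_minus_cosine_bound:
  fixes x e :: "'a::real_inner"
  assumes "norm e = 1" and "x \<bullet> e > 0"
  shows "1 - (x \<bullet> e) / norm x \<le> (norm (x - (x \<bullet> e) *\<^sub>R e))\<^sup>2 / (x \<bullet> e)\<^sup>2"
proof -
  define a where "a = x \<bullet> e"
  define N where "N = norm x"
  have "a \<le> N"
    using norm_cauchy_schwarz[of x e] assms(1) by (simp add: a_def N_def)
  have a: "a > 0" using assms(2) by (simp add: a_def)
  have "(norm (x - a *\<^sub>R e))\<^sup>2 = (norm x)\<^sup>2 - 2 * a * (x \<bullet> e) + a\<^sup>2 * (norm e)\<^sup>2"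
    by (simp only: power2_norm_eq_inner) (simp add: inner_diff inner_commute power2_eq_square algebra_simps)
  also have "\<dots> = N\<^sup>2 - a\<^sup>2"
    by (simp add: assms(1) N_def a_def power2_eq_square)
  finally have q: "(norm (x - a *\<^sub>R e))\<^sup>2 = N\<^sup>2 - a\<^sup>2" .
  have "(1 - a / N) * a\<^sup>2 \<le> N\<^sup>2 - a\<^sup>2"
  proof -
    have "(1 - a / N) * a\<^sup>2 \<le> (N - a) * a"
    proof -
      have "(1 - a / N) * a\<^sup>2 = (N - a) * a * (a / N)"
        using a \<open>a \<le> N\<close> by (simp add: field_simps power2_eq_square)
      also have "\<dots> \<le> (N - a) * a * 1"
        using a \<open>a \<le> N\<close> by (intro mult_left_mono) auto
      finally show ?thesis by simp
    qed
    also have "\<dots> \<le> (N - a) * (N + a)"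
      using a \<open>a \<le> N\<close> by (intro mult_left_mono) auto
    also have "\<dots> = N\<^sup>2 - a\<^sup>2" by (simp add: power2_eq_square algebra_simps)
    finally show ?thesis .
  qed
  then show ?thesis
    using a q unfolding a_def[symmetric] N_def[symmetric]
    by (simp add: pos_le_divide_eq)
qed

lemma cosine_le_1:
  fixes x e :: "'a::real_inner"
  assumes "norm e = 1" shows "\<bar>(x \<bullet> e) / norm x\<bar> \<le> 1"
proof -
  have "\<bar>x \<bullet> e\<bar> \<le> norm x"
    using Cauchy_Schwarz_ineq2[of x e] assms by simp
  then show ?thesis
    by (cases "x = 0") (auto simp: divide_le_eq_1)
qed

text \<open>
  From \<open>y cos y \<le> sin y\<close> at \<open>y = x/2\<close> and the double angle formulas,
  \<open>sin x \<ge> x cos\<^sup>2 (x/2) = x (1 + cos x) / 2\<close>.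
\<close>
lemma sin_ge_half:
  assumes "0 \<le> x" "x \<le> pi/2" shows "x / 2 \<le> sin x"
proof -
  have y: "y * cos y \<le> sin y" if "0 \<le> y" "y \<le> pi" for y
  proof -
    have "sin 0 - 0 * cos 0 \<le> sin y - y * cos y"
    proof (rule DERIV_nonneg_imp_nondecreasing[OF that(1)])
      fix t assume "0 \<le> t" "t \<le> y"
      then show "\<exists>d. ((\<lambda>t. sin t - t * cos t) has_real_derivative d) (at t) \<and> 0 \<le> d"
        using that sin_ge_zero[of t]
        by (intro exI[of _ "t * sin t"]) (auto intro!: derivative_eq_intros)
    qed
    then show ?thesis by simp
  qed
  have c: "0 \<le> cos (x/2)" and cx: "0 \<le> cos x"
    using assms by (auto intro!: cos_ge_zero)
  have "x / 2 * 1 \<le> x / 2 * (1 + cos x)"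
    using assms cx by (intro mult_left_mono) auto
  also have "\<dots> = 2 * (x/2 * cos (x/2)) * cos (x/2)"
    using cos_double_cos[of "x/2"] by (simp add: power2_eq_square)
  also have "\<dots> \<le> 2 * sin (x/2) * cos (x/2)"
    using y[of "x/2"] assms c by (intro mult_right_mono) auto
  also have "\<dots> = sin x"
    using sin_double[of "x/2"] by simp
  finally show ?thesis by simp
qed

lemma set_integrable_inverse_1_plus_square_atLeast_0:
  "set_integrable lborel {0..} (\<lambda>t::real. inverse (1 + t\<^sup>2))"
proof -
  have "(\<integral>\<^sup>+t. ennreal (inverse (1 + t\<^sup>2)) * indicator {0..} t \<partial>lborel) = pi/2 - arctan 0"
    by (rule nn_integral_FTC_atLeast)
      (auto intro!: derivative_eq_intros tendsto_arctan_at_top)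
  then show ?thesis
    unfolding set_integrable_def
    by (intro integrableI_nonneg) (auto simp: indicator_mult_ennreal mult.commute ennreal_indicator[symmetric] ennreal_mult'')
qed

text \<open>
  One side of a zero of the unperturbed curve: \<open>t\<close> is the distance from the zero, \<open>\<kappa> sin t\<close> the
  unperturbed curve, which runs along the unit vector \<open>e\<close>, and \<open>\<epsilon> n *\<^sub>R z n\<close> the perturbation. Only the
  value \<open>U\<close> of the perturbation at the zero, seen at the scale \<open>\<epsilon> n\<close>, influences the limit. The case
  \<open>\<kappa> = 0\<close> is included for the half period on which the unperturbed curve vanishes.
\<close>
locale blow_up =
  fixes \<kappa> :: real and e U :: "'a::euclidean_space" and \<epsilon> :: "nat \<Rightarrow> real"
    and z :: "nat \<Rightarrow> real \<Rightarrow> 'a" and C :: real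
  assumes \<kappa>: "\<kappa> \<ge> 0" and e: "norm e = 1"
    and \<epsilon>_pos: "\<And>n. \<epsilon> n > 0" and \<epsilon>_lim: "\<epsilon> \<longlonglongrightarrow> 0"
    and z_meas: "\<And>n. z n \<in> borel_measurable borel"
    and z_bound: "\<And>n t. t \<in> {0..pi/2} \<Longrightarrow> norm (z n t) \<le> C"
    and z_lim: "\<And>t. t \<ge> 0 \<Longrightarrow> (\<lambda>n. z n (\<epsilon> n * t)) \<longlonglongrightarrow> U"
begin

definition profile :: "nat \<Rightarrow> real \<Rightarrow> 'a" where
  "profile n t = (\<kappa> * sin t) *\<^sub>R e + \<epsilon> n *\<^sub>R z n t"

text \<open>
  The cosine of the angle between the curve and \<open>e\<close>, minus \<open>1\<close>. Where the curve vanishes, division by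
  zero makes it \<open>-1\<close>, which respects the bounds \<open>-2\<close> and \<open>0\<close>.
\<close>
definition deficit :: "nat \<Rightarrow> real \<Rightarrow> real" where
  "deficit n t = (profile n t \<bullet> e) / norm (profile n t) - 1"

definition limit_profile :: "real \<Rightarrow> 'a" where "limit_profile t = (\<kappa> * t) *\<^sub>R e + U"

text \<open>
  The substitution \<open>s = \<epsilon> n * t\<close> absorbs the factor \<open>1 / \<epsilon> n\<close> (lemma \<open>rescale\<close>) and turns the interval
  \<open>{0..pi/2}\<close> into one that exhausts the half line.
\<close>
definition scaled_deficit :: "nat \<Rightarrow> real \<Rightarrow> real" where
  "scaled_deficit n t = indicator {0..pi/2} (\<epsilon> n * t) *\<^sub>R deficit n (\<epsilon> n * t)"

definition limit_deficit :: "real \<Rightarrow> real" where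
  "limit_deficit t = (limit_profile t \<bullet> e) / norm (limit_profile t) - 1"

lemma deficit_measurable [measurable]: "deficit n \<in> borel_measurable borel"
  unfolding deficit_def[abs_def] profile_def[abs_def] using z_meas[of n, measurable] by measurable

lemma scaled_deficit_measurable [measurable]: "scaled_deficit n \<in> borel_measurable borel"
  unfolding scaled_deficit_def[abs_def] by measurable

lemma limit_deficit_measurable [measurable]: "limit_deficit \<in> borel_measurable borel"
  unfolding limit_deficit_def[abs_def] limit_profile_def[abs_def] by measurable

lemma deficit_bounds: "-2 \<le> deficit n t" "deficit n t \<le> 0"
  using cosine_le_1[OF e, of "profile n t"] unfolding deficit_def by linarith+

lemma deficit_abs: "\<bar>deficit n t\<bar> \<le> 2"
  using deficit_bounds[of n t] by linarith

lemma rescale: "(LINT t:{0..pi/2}|lborel. deficit n t) / \<epsilon> n = (\<integral>t. scaled_deficit n t \<partial>lborel)"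
  using lborel_integral_real_affine[of "\<epsilon> n" "\<lambda>t. indicator {0..pi/2} t *\<^sub>R deficit n t" 0] \<epsilon>_pos[of n]
  by (simp add: set_lebesgue_integral_def scaled_deficit_def)

lemma scaled_deficit_lim:
  assumes "t \<ge> 0" and "limit_profile t \<noteq> 0"
  shows "(\<lambda>n. scaled_deficit n t) \<longlonglongrightarrow> limit_deficit t"
proof -
  have \<epsilon>t: "(\<lambda>n. \<epsilon> n * t) \<longlonglongrightarrow> 0"
    using tendsto_mult_right[OF \<epsilon>_lim, of t] by simp
  have sinc: "(\<lambda>n. sin (\<epsilon> n * t) / \<epsilon> n) \<longlonglongrightarrow> t"
  proof -
    have "(\<lambda>h. sin (h * t) / h) \<midarrow>0\<rightarrow> t"
    proof -
      have "((\<lambda>h. sin (h * t)) has_real_derivative cos (0 * t) * t) (at 0)"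
        by (auto intro!: derivative_eq_intros)
      then show ?thesis by (simp add: has_field_derivative_iff)
    qed
    moreover have "filterlim \<epsilon> (at 0) sequentially"
      using \<epsilon>_lim \<epsilon>_pos by (simp add: filterlim_at less_imp_neq[symmetric])
    ultimately show ?thesis by (rule filterlim_compose)
  qed
  define W where "W n = (\<kappa> * (sin (\<epsilon> n * t) / \<epsilon> n)) *\<^sub>R e + z n (\<epsilon> n * t)" for n
  have W: "W \<longlonglongrightarrow> limit_profile t"
    unfolding W_def[abs_def] limit_profile_def by (intro tendsto_intros sinc z_lim assms)
  have ZW: "profile n (\<epsilon> n * t) = \<epsilon> n *\<^sub>R W n" for n
    using \<epsilon>_pos[of n] by (simp add: profile_def W_def scaleR_add_right)
  have "deficit n (\<epsilon> n * t) = (W n \<bullet> e) / norm (W n) - 1" for n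
    using \<epsilon>_pos[of n] by (simp add: deficit_def ZW)
  moreover have "(\<lambda>n. (W n \<bullet> e) / norm (W n) - 1) \<longlonglongrightarrow> limit_deficit t"
    unfolding limit_deficit_def using assms(2) by (intro tendsto_intros W) auto
  ultimately have conv: "(\<lambda>n. deficit n (\<epsilon> n * t)) \<longlonglongrightarrow> limit_deficit t" by simp
  have "eventually (\<lambda>n. \<epsilon> n * t < pi/2) sequentially"
    by (rule order_tendstoD(2)[OF \<epsilon>t]) simp
  then have "eventually (\<lambda>n. deficit n (\<epsilon> n * t) = scaled_deficit n t) sequentially"
    by eventually_elim (use \<epsilon>_pos assms(1) in \<open>auto simp: scaled_deficit_def less_imp_le\<close>)
  then show ?thesis by (rule Lim_transform_eventually[OF conv])
qed

lemma scaled_deficit_neg: "t < 0 \<Longrightarrow> scaled_deficit n t = 0"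
  using \<epsilon>_pos[of n] by (simp add: scaled_deficit_def indicator_def mult_le_0_iff zero_le_mult_iff)

lemma scaled_deficit_bounds: "-2 \<le> scaled_deficit n t" "scaled_deficit n t \<le> 0"
  using deficit_bounds[of n "\<epsilon> n * t"] by (auto simp: scaled_deficit_def indicator_def)

lemma scaled_deficit_abs: "\<bar>scaled_deficit n t\<bar> \<le> 2"
  using scaled_deficit_bounds[of n t] by linarith

text \<open>
  For large \<open>t\<close> the rescaled curve has a component of size at least \<open>\<kappa> t / 4\<close> along \<open>e\<close> and a bounded
  transversal part, so that the deficit is of order \<open>1 / t\<^sup>2\<close> uniformly in \<open>n\<close>. For bounded \<open>t\<close> the
  trivial bound \<open>2\<close> is enough.
\<close>
lemma scaled_deficit_dominated:
  assumes "\<kappa> > 0"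
  shows "\<exists>B. \<forall>n t. \<bar>scaled_deficit n t\<bar> \<le> B * (indicator {0..} t * inverse (1 + t\<^sup>2))"
proof -
  define k where "k = \<kappa> / 2"
  \<comment> \<open>Beyond \<open>T\<close> the perturbation takes away at most half of the lower bound for the component along \<open>e\<close>.\<close>
  define T where "T = max 1 (2 * C / k)"
  define K where "K = 16 * C\<^sup>2 / k\<^sup>2"
  have k: "k > 0" using assms by (simp add: k_def)
  have T: "T \<ge> 1" "k * T \<ge> 2 * C"
    using k by (auto simp: T_def field_simps max_def)
  have K: "K \<ge> 0" by (simp add: K_def)
  have "\<bar>scaled_deficit n t\<bar> \<le> (2 * K + 2 * (1 + T\<^sup>2)) * (indicator {0..} t * inverse (1 + t\<^sup>2))" for n t
  proof (cases "0 \<le> t \<and> \<epsilon> n * t \<le> pi/2")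
    case False
    then have "scaled_deficit n t = 0" using scaled_deficit_neg[of t n] by (auto simp: scaled_deficit_def)
    then show ?thesis using K by (simp add: indicator_def)
  next
    case True
    then have Ff: "scaled_deficit n t = deficit n (\<epsilon> n * t)" and t: "t \<ge> 0"
      using \<epsilon>_pos[of n] by (simp_all add: scaled_deficit_def)
    have D: "1 + t\<^sup>2 > 0" by (simp add: add_pos_nonneg)
    have "\<bar>scaled_deficit n t\<bar> * (1 + t\<^sup>2) \<le> 2 * K + 2 * (1 + T\<^sup>2)"
    proof (cases "t \<le> T")
      case True
      have "\<bar>scaled_deficit n t\<bar> * (1 + t\<^sup>2) \<le> 2 * (1 + T\<^sup>2)"
        using scaled_deficit_bounds[of n t] True t by (intro mult_mono add_left_mono power_mono) auto
      then show ?thesis using K by simp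
    next
      case False
      define x where "x = profile n (\<epsilon> n * t)"
      define w where "w = z n (\<epsilon> n * t)"
      have w: "norm w \<le> C"
        unfolding w_def using \<open>0 \<le> t \<and> \<epsilon> n * t \<le> pi/2\<close> \<epsilon>_pos[of n] by (intro z_bound) auto
      have we: "\<bar>w \<bullet> e\<bar> \<le> C"
        using Cauchy_Schwarz_ineq2[of w e] w e by simp
      have ee: "e \<bullet> e = 1" using e by (simp add: dot_square_norm)
      have x: "x = (\<kappa> * sin (\<epsilon> n * t)) *\<^sub>R e + \<epsilon> n *\<^sub>R w"
        by (simp add: x_def w_def profile_def)
      have xe: "x \<bullet> e = \<kappa> * sin (\<epsilon> n * t) + \<epsilon> n * (w \<bullet> e)"
        by (simp add: x_def w_def profile_def inner_add_left ee)
      have kt: "k * t \<ge> 2 * C"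
        using False T k mult_left_mono[of T t k] by linarith
      have "\<kappa> * ((\<epsilon> n * t) / 2) \<le> \<kappa> * sin (\<epsilon> n * t)"
        using \<open>0 \<le> t \<and> \<epsilon> n * t \<le> pi/2\<close> \<epsilon>_pos[of n] \<kappa> by (intro mult_left_mono sin_ge_half) auto
      moreover have "\<epsilon> n * (- C) \<le> \<epsilon> n * (w \<bullet> e)"
        using we \<epsilon>_pos[of n] by (intro mult_left_mono) auto
      moreover have "\<epsilon> n * (k * t / 2) \<le> \<epsilon> n * (k * t - C)"
        using kt \<epsilon>_pos[of n] by (intro mult_left_mono) auto
      ultimately have lower: "\<epsilon> n * (k * t / 2) \<le> x \<bullet> e"
        by (simp add: xe k_def algebra_simps)
      have pos: "0 < \<epsilon> n * (k * t / 2)"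
        using \<epsilon>_pos[of n] k False T by simp
      have perp: "norm (x - (x \<bullet> e) *\<^sub>R e) \<le> \<epsilon> n * (2 * C)"
      proof -
        have "x - (x \<bullet> e) *\<^sub>R e = \<epsilon> n *\<^sub>R (w - (w \<bullet> e) *\<^sub>R e)"
          unfolding xe by (simp add: x algebra_simps)
        moreover have "norm (w - (w \<bullet> e) *\<^sub>R e) \<le> C + C"
          using w we e by (intro order_trans[OF norm_triangle_ineq4] add_mono) auto
        ultimately show ?thesis using \<epsilon>_pos[of n] by simp
      qed
      have "\<bar>scaled_deficit n t\<bar> = 1 - (x \<bullet> e) / norm x"
        using deficit_bounds(2)[of n "\<epsilon> n * t"] by (simp add: Ff deficit_def x_def)
      also have "\<dots> \<le> (norm (x - (x \<bullet> e) *\<^sub>R e))\<^sup>2 / (x \<bullet> e)\<^sup>2"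
        using pos lower by (intro one_minus_cosine_bound e) auto
      also have "\<dots> \<le> (\<epsilon> n * (2 * C))\<^sup>2 / (\<epsilon> n * (k * t / 2))\<^sup>2"
        using pos lower perp by (intro frac_le power_mono) auto
      also have "\<dots> = K / t\<^sup>2"
        using \<epsilon>_pos[of n] k False T by (simp add: K_def power2_eq_square field_simps)
      finally have "\<bar>scaled_deficit n t\<bar> * (1 + t\<^sup>2) \<le> K / t\<^sup>2 * (1 + t\<^sup>2)"
        by (intro mult_right_mono) auto
      also have "\<dots> \<le> K / t\<^sup>2 * (2 * t\<^sup>2)"
        using K False T by (intro mult_left_mono) (auto intro: one_le_power)
      also have "\<dots> = 2 * K" using False T by simp
      finally show ?thesis by (simp add: add_increasing2)
    qed
    then show ?thesis using t D by (simp add: field_simps)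
  qed
  then show ?thesis by blast
qed

text \<open>
  The length of a long vector exceeds its component along \<open>e\<close> by at most the square of the transversal
  part divided by that component.
\<close>
lemma limit_profile_at_top: "\<kappa> > 0 \<Longrightarrow> ((\<lambda>b. norm (limit_profile b) - \<kappa> * b) \<longlongrightarrow> U \<bullet> e) at_top"
proof -
  assume \<kappa>: "\<kappa> > 0"
  have ee: "e \<bullet> e = 1" using e by (simp add: dot_square_norm)
  have Ve: "limit_profile b \<bullet> e = \<kappa> * b + U \<bullet> e" for b
    by (simp add: limit_profile_def inner_add_left ee)
  have Vp: "limit_profile b - (limit_profile b \<bullet> e) *\<^sub>R e = U - (U \<bullet> e) *\<^sub>R e" for b
    unfolding Ve by (simp add: limit_profile_def algebra_simps)
  define q where "q = (norm (U - (U \<bullet> e) *\<^sub>R e))\<^sup>2"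
  have lin: "filterlim (\<lambda>b. \<kappa> * b + U \<bullet> e) at_top at_top"
    using filterlim_tendsto_add_at_top[OF tendsto_const[of "U \<bullet> e"]
        filterlim_tendsto_pos_mult_at_top[OF tendsto_const \<kappa> filterlim_ident]]
    by (simp add: add.commute)
  have up: "norm (limit_profile b) - \<kappa> * b \<le> U \<bullet> e + q / (\<kappa> * b + U \<bullet> e)" if "\<kappa> * b + U \<bullet> e > 0" for b
  proof -
    have p: "limit_profile b \<bullet> e > 0" using that by (simp add: Ve)
    have "q = (norm (limit_profile b))\<^sup>2 - (limit_profile b \<bullet> e)\<^sup>2"
      unfolding q_def Vp[symmetric, of b]
      by (simp only: power2_norm_eq_inner) (simp add: inner_diff inner_commute ee power2_eq_square algebra_simps)
    then have "q = (norm (limit_profile b) - limit_profile b \<bullet> e) * (norm (limit_profile b) + limit_profile b \<bullet> e)"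
      by (simp add: power2_eq_square algebra_simps)
    moreover have "norm (limit_profile b) - limit_profile b \<bullet> e \<ge> 0"
      using norm_cauchy_schwarz[of "limit_profile b" e] e by simp
    ultimately have "(norm (limit_profile b) - limit_profile b \<bullet> e) * (limit_profile b \<bullet> e) \<le> q"
      by (simp add: mult_left_mono)
    then have "norm (limit_profile b) - limit_profile b \<bullet> e \<le> q / (limit_profile b \<bullet> e)"
      using p by (simp add: pos_le_divide_eq)
    then show ?thesis by (simp add: Ve)
  qed
  show ?thesis
  proof (rule tendsto_sandwich)
    show "\<forall>\<^sub>F b in at_top. U \<bullet> e \<le> norm (limit_profile b) - \<kappa> * b"
    proof (intro always_eventually allI)
      fix b show "U \<bullet> e \<le> norm (limit_profile b) - \<kappa> * b"
        using norm_cauchy_schwarz[of "limit_profile b" e] e Ve[of b] by simp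
    qed
    show "\<forall>\<^sub>F b in at_top. norm (limit_profile b) - \<kappa> * b \<le> U \<bullet> e + q / (\<kappa> * b + U \<bullet> e)"
      using filterlim_at_top_dense[THEN iffD1, OF lin, rule_format, of 0]
      by eventually_elim (rule up)
    show "((\<lambda>b. U \<bullet> e + q / (\<kappa> * b + U \<bullet> e)) \<longlongrightarrow> U \<bullet> e) at_top"
      using tendsto_add[OF tendsto_const tendsto_divide_0[OF tendsto_const filterlim_at_top_imp_at_infinity[OF lin]], of "U \<bullet> e" q]
      by simp
  qed simp
qed

text \<open>
  The integrand is the derivative of \<open>(|V t| - \<kappa> t) / \<kappa>\<close> for \<open>V = limit_profile\<close>, except at the one
  parameter at which the ray may pass through the origin.
\<close>
lemma limit_deficit_integral:
  assumes "\<kappa> > 0" and "b \<ge> 0" and G: "set_integrable lborel {0..b} limit_deficit"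
  shows "(LINT t:{0..b}|lborel. limit_deficit t) = (norm (limit_profile b) - \<kappa> * b - norm U) / \<kappa>"
proof -
  define P where "P t = (norm (limit_profile t) - \<kappa> * t) / \<kappa>" for t
  define t0 where "t0 = - (U \<bullet> e) / \<kappa>"
  have ee: "e \<bullet> e = 1" using e by (simp add: dot_square_norm)
  have V0: "limit_profile t \<noteq> 0" if "t \<noteq> t0" for t
  proof
    assume "limit_profile t = 0"
    then have "limit_profile t \<bullet> e = 0" by simp
    then show False
      using that \<open>\<kappa> > 0\<close> by (simp add: limit_profile_def inner_add_left ee t0_def field_simps)
  qed
  have "(limit_deficit has_integral (P b - P 0)) {0..b}"
  proof (rule fundamental_theorem_of_calculus_interior_strong[of "{t0}"])
    fix t assume "t \<in> {0<..<b} - {t0}"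
    then have "limit_profile t \<noteq> 0" using V0 by auto
    have "(limit_profile has_derivative (\<lambda>h. (\<kappa> * h) *\<^sub>R e)) (at t)"
      unfolding limit_profile_def[abs_def] by (auto intro!: derivative_eq_intros)
    from has_derivative_compose[OF this has_derivative_norm[OF \<open>limit_profile t \<noteq> 0\<close>]]
    have "((\<lambda>t. norm (limit_profile t)) has_derivative (\<lambda>h. (\<kappa> * (sgn (limit_profile t) \<bullet> e)) * h)) (at t)"
      by (simp add: mult_ac inner_commute)
    then have "((\<lambda>t. norm (limit_profile t)) has_real_derivative \<kappa> * (sgn (limit_profile t) \<bullet> e)) (at t)"
      by (simp add: has_field_derivative_def)
    then have "(P has_real_derivative (\<kappa> * (sgn (limit_profile t) \<bullet> e) - \<kappa> * 1) / \<kappa>) (at t)"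
      unfolding P_def[abs_def] by (intro DERIV_cdivide DERIV_diff DERIV_cmult DERIV_ident)
    also have "(\<kappa> * (sgn (limit_profile t) \<bullet> e) - \<kappa> * 1) / \<kappa> = limit_deficit t"
      using \<open>\<kappa> > 0\<close> \<open>limit_profile t \<noteq> 0\<close> by (simp add: limit_deficit_def sgn_div_norm field_simps)
    finally show "(P has_vector_derivative limit_deficit t) (at t)"
      by (simp add: has_real_derivative_iff_has_vector_derivative)
  next
    show "continuous_on {0..b} P"
      unfolding P_def[abs_def] limit_profile_def[abs_def] using \<open>\<kappa> > 0\<close> by (intro continuous_intros) auto
  qed (use \<open>b \<ge> 0\<close> in auto)
  then have "(LINT t:{0..b}|lborel. limit_deficit t) = P b - P 0"
    using set_borel_integral_eq_integral(2)[OF G] by (simp add: integral_unique)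
  then show ?thesis
    by (simp add: P_def limit_profile_def diff_divide_distrib)
qed

text \<open>
  Dominated convergence reduces the claim to the integral of the limit over the half line, which is the
  limit of the integrals over \<open>{0..b}\<close> and known in closed form.
\<close>
lemma limit_transversal:
  assumes "\<kappa> > 0"
  shows "(\<lambda>n. (LINT t:{0..pi/2}|lborel. deficit n t) / \<epsilon> n) \<longlonglongrightarrow> (U \<bullet> e - norm U) / \<kappa>"
proof -
  obtain B where B: "\<And>n t. \<bar>scaled_deficit n t\<bar> \<le> B * (indicator {0..} t * inverse (1 + t\<^sup>2))"
    using scaled_deficit_dominated[OF assms] by blast
  define t0 where "t0 = - (U \<bullet> e) / \<kappa>"
  have ee: "e \<bullet> e = 1" using e by (simp add: dot_square_norm)
  have dom: "integrable lborel (\<lambda>t. B * (indicator {0..} t * inverse (1 + t\<^sup>2)))"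
    using set_integrable_inverse_1_plus_square_atLeast_0
    by (intro integrable_mult_right) (simp add: set_integrable_def)
  have lim: "AE t in lborel. (\<lambda>n. scaled_deficit n t) \<longlonglongrightarrow> indicator {0..} t *\<^sub>R limit_deficit t"
    using AE_lborel_singleton[of t0]
  proof eventually_elim
    case (elim t)
    have "limit_profile t \<noteq> 0"
    proof
      assume "limit_profile t = 0"
      then have "limit_profile t \<bullet> e = 0" by simp
      then show False
        using elim \<open>\<kappa> > 0\<close> by (simp add: limit_profile_def inner_add_left ee t0_def field_simps)
    qed
    then show ?case
      using scaled_deficit_lim[of t] scaled_deficit_neg[of t] by (cases "t \<ge> 0") auto
  qed
  have m: "(\<lambda>t. indicator {0..} t *\<^sub>R limit_deficit t) \<in> borel_measurable lborel" "\<And>n. scaled_deficit n \<in> borel_measurable lborel"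
    by simp_all
  have G: "set_integrable lborel {0..} limit_deficit"
    unfolding set_integrable_def
    by (rule integrable_dominated_convergence[OF m dom lim]) (use B in simp)
  have conv: "(\<lambda>n. \<integral>t. scaled_deficit n t \<partial>lborel) \<longlonglongrightarrow> (LINT t:{0..}|lborel. limit_deficit t)"
    unfolding set_lebesgue_integral_def
    by (rule integral_dominated_convergence[OF m dom lim]) (use B in simp)
  have "((\<lambda>b. LINT t:{0..b}|lborel. limit_deficit t) \<longlongrightarrow> (LINT t:{0..}|lborel. limit_deficit t)) at_top"
    by (rule tendsto_set_lebesgue_integral_at_top[OF _ G]) simp
  moreover have "((\<lambda>b. LINT t:{0..b}|lborel. limit_deficit t) \<longlongrightarrow> (U \<bullet> e - norm U) / \<kappa>) at_top"
  proof (rule Lim_transform_eventually)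
    show "((\<lambda>b. (norm (limit_profile b) - \<kappa> * b - norm U) / \<kappa>) \<longlongrightarrow> (U \<bullet> e - norm U) / \<kappa>) at_top"
      using assms by (intro tendsto_intros limit_profile_at_top) auto
    show "\<forall>\<^sub>F b in at_top. (norm (limit_profile b) - \<kappa> * b - norm U) / \<kappa> = (LINT t:{0..b}|lborel. limit_deficit t)"
      using eventually_ge_at_top[of 0]
      by eventually_elim (auto intro!: limit_deficit_integral[symmetric] assms set_integrable_subset[OF G])
  qed
  ultimately have "(LINT t:{0..}|lborel. limit_deficit t) = (U \<bullet> e - norm U) / \<kappa>"
    by (intro tendsto_unique[OF trivial_limit_at_top_linorder])
  then show ?thesis using conv by (simp add: rescale)
qed

text \<open>
  If \<open>\<kappa> = 0\<close>, the rescaled direction tends to the constant \<open>U / |U|\<close>. A deficit of this limit would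
  contribute an amount proportional to the length \<open>T\<close> of the rescaled interval, for arbitrarily large \<open>T\<close>,
  against the fixed bound \<open>B\<close>.
\<close>
lemma limit_degenerate:
  assumes "\<kappa> = 0" and B: "\<And>n. - B \<le> (LINT t:{0..pi/2}|lborel. deficit n t) / \<epsilon> n"
  shows "U \<bullet> e = norm U"
proof (rule ccontr)
  assume neq: "U \<bullet> e \<noteq> norm U"
  then have "U \<noteq> 0" by auto
  define g where "g = (U \<bullet> e) / norm U - 1"
  have "U \<bullet> e < norm U"
    using norm_cauchy_schwarz[of U e] e neq by simp
  then have g: "g < 0" using \<open>U \<noteq> 0\<close> by (simp add: g_def divide_less_eq)
  \<comment> \<open>The length at which the loss \<open>- T * g\<close> exceeds \<open>B\<close>.\<close>
  define T where "T = (\<bar>B\<bar> + 1) / (- g)"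
  have T: "T > 0" "T * g = - (\<bar>B\<bar> + 1)"
    using g by (simp_all add: T_def divide_pos_neg)
  have Fi: "integrable lborel (scaled_deficit n)" for n
  proof -
    have "integrable lborel (\<lambda>t. indicator {0..pi/2} t *\<^sub>R deficit n t)"
    proof (rule Bochner_Integration.integrable_bound)
      show "integrable lborel (\<lambda>t. indicator {0..pi/2} t *\<^sub>R (2::real))"
        using borel_integrable_atLeastAtMost'[of 0 "pi/2" "\<lambda>_. 2::real"] by (simp add: set_integrable_def)
      show "AE t in lborel. norm (indicator {0..pi/2} t *\<^sub>R deficit n t) \<le> norm (indicator {0..pi/2} t *\<^sub>R (2::real))"
        using deficit_abs[of n] by (intro AE_I2) (auto simp: indicator_def)
    qed simp
    from lborel_integrable_real_affine[OF this, of "\<epsilon> n" 0] show ?thesis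
      using \<epsilon>_pos[of n] by (simp add: scaled_deficit_def[abs_def])
  qed
  have "(\<lambda>n. \<integral>t. indicator {0..T} t *\<^sub>R scaled_deficit n t \<partial>lborel) \<longlonglongrightarrow> (\<integral>t. indicator {0..T} t *\<^sub>R g \<partial>lborel)"
  proof (rule integral_dominated_convergence)
    show "integrable lborel (\<lambda>t. indicator {0..T} t *\<^sub>R (2::real))"
      using borel_integrable_atLeastAtMost'[of 0 T "\<lambda>_. 2::real"] by (simp add: set_integrable_def)
    have "limit_profile t = U" for t unfolding limit_profile_def using assms(1) by simp
    then show "AE t in lborel. (\<lambda>n. indicator {0..T} t *\<^sub>R scaled_deficit n t) \<longlonglongrightarrow> indicator {0..T} t *\<^sub>R g"
      using scaled_deficit_lim \<open>U \<noteq> 0\<close> by (intro AE_I2) (auto simp: indicator_def limit_deficit_def g_def)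
    show "AE t in lborel. norm (indicator {0..T} t *\<^sub>R scaled_deficit n t) \<le> indicator {0..T} t *\<^sub>R 2" for n
      using scaled_deficit_abs[of n] by (intro AE_I2) (auto simp: indicator_def)
  qed simp_all
  moreover have "- B \<le> (\<integral>t. indicator {0..T} t *\<^sub>R scaled_deficit n t \<partial>lborel)" for n
  proof -
    have "- B \<le> (\<integral>t. scaled_deficit n t \<partial>lborel)" using B[of n] by (simp add: rescale)
    also have "\<dots> \<le> (\<integral>t. indicator {0..T} t *\<^sub>R scaled_deficit n t \<partial>lborel)"
      using scaled_deficit_bounds Fi[of n]
      by (intro integral_mono Fi integrable_mult_indicator) (auto simp: indicator_def)
    finally show ?thesis .
  qed
  ultimately have "- B \<le> (\<integral>t. indicator {0..T} t *\<^sub>R g \<partial>lborel)"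
    by (intro LIMSEQ_le_const) auto
  also have "\<dots> = T * g" using T by simp
  finally show False using T by simp
qed

end

section \<open>The linearised constraint\<close>

lemma set_integral_reflect:
  fixes k :: "real \<Rightarrow> real"
  shows "(LINT s:{p - l..p}|lborel. k s) = (LINT t:{0..l}|lborel. k (p + (-1) * t))"
    and set_integral_shift: "(LINT s:{p..p + l}|lborel. k s) = (LINT t:{0..l}|lborel. k (p + 1 * t))"
proof -
  have "indicator {p - l..p} (p + (-1) * t) = (indicator {0..l} t :: real)"
    "indicator {p..p + l} (p + 1 * t) = (indicator {0..l} t :: real)" for t
    by (auto simp: indicator_def)
  then show "(LINT s:{p - l..p}|lborel. k s) = (LINT t:{0..l}|lborel. k (p + (-1) * t))"
    "(LINT s:{p..p + l}|lborel. k s) = (LINT t:{0..l}|lborel. k (p + 1 * t))"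
    using lborel_integral_real_affine[of "-1" "\<lambda>s. indicator {p - l..p} s *\<^sub>R k s" p]
      lborel_integral_real_affine[of 1 "\<lambda>s. indicator {p..p + l} s *\<^sub>R k s" p]
    unfolding set_lebesgue_integral_def by simp_all
qed

text \<open>
  The one-parameter family is followed along a sequence \<open>\<mu> = \<epsilon> n * m\<close> with fixed \<open>m\<close> and positive
  \<open>\<epsilon> n\<close>. The sign of \<open>\<mu>\<close> is then contained in \<open>h = m *\<^sub>R x\<^sub>1\<close>, and \<open>Y n\<close> is the perturbed curve.
\<close>
locale perturbed_sequence =
  fixes \<alpha> \<beta> :: real and h :: "real \<Rightarrow> real^3" and \<epsilon> :: "nat \<Rightarrow> real" and Y :: "nat \<Rightarrow> real \<Rightarrow> real^3"
  assumes \<alpha>: "\<alpha> > 0" and \<beta>: "0 \<le> \<beta>"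
    and h: "h \<in> H1_per" and Y: "\<And>n. Y n \<in> H1_per"
    and \<epsilon>_pos: "\<And>n. \<epsilon> n > 0" and \<epsilon>_lim: "\<epsilon> \<longlonglongrightarrow> 0"
    and rem: "(\<lambda>n. H1_norm (\<lambda>s. Y n s - X0 \<alpha> \<beta> s - \<epsilon> n *\<^sub>R h s) / \<epsilon> n) \<longlonglongrightarrow> 0"
begin

definition increment :: "nat \<Rightarrow> real \<Rightarrow> real^3" where
  "increment n s = (1 / \<epsilon> n) *\<^sub>R (Y n s - X0 \<alpha> \<beta> s)"

lemma Y_eq: "Y n s = X0 \<alpha> \<beta> s + \<epsilon> n *\<^sub>R increment n s"
  using \<epsilon>_pos[of n] by (simp add: increment_def)

lemma increment_H1_per: "increment n \<in> H1_per"
  unfolding increment_def[abs_def] by (intro H1_per_scaleR H1_per_diff Y X0_H1_per)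

lemma increment_h_H1_norm: "(\<lambda>n. H1_norm (\<lambda>s. increment n s - h s)) \<longlonglongrightarrow> 0"
proof -
  have "H1_norm (\<lambda>s. increment n s - h s) = H1_norm (\<lambda>s. Y n s - X0 \<alpha> \<beta> s - \<epsilon> n *\<^sub>R h s) / \<epsilon> n" for n
  proof -
    have "(\<lambda>s. increment n s - h s) = (\<lambda>s. (1 / \<epsilon> n) *\<^sub>R (Y n s - X0 \<alpha> \<beta> s - \<epsilon> n *\<^sub>R h s))"
      using \<epsilon>_pos[of n] by (simp add: increment_def scaleR_diff_right)
    then show ?thesis
      using \<epsilon>_pos[of n] by (simp add: H1_norm_scaleR H1_per_diff H1_per_scaleR Y X0_H1_per h)
  qed
  then show ?thesis using rem by simp
qed

lemma increment_uniform: "\<exists>\<eta>. \<eta> \<longlonglongrightarrow> 0 \<and> (\<forall>n. \<forall>s\<in>{0..2*pi}. norm (increment n s - h s) \<le> \<eta> n)"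
proof -
  obtain C where C: "\<And>f x. f \<in> H1_per \<Longrightarrow> x \<in> {0..2*pi} \<Longrightarrow> norm (f x) \<le> C * H1_norm f"
    using sup_le_H1_norm by blast
  have "(\<lambda>n. C * H1_norm (\<lambda>s. increment n s - h s)) \<longlonglongrightarrow> 0"
    using tendsto_mult_left[OF increment_h_H1_norm, of C] by simp
  then show ?thesis
    using C[OF H1_per_diff[OF increment_H1_per h]] by blast
qed

lemma increment_pointwise: "s \<in> {0..2*pi} \<Longrightarrow> (\<lambda>n. increment n s) \<longlonglongrightarrow> h s"
proof -
  assume s: "s \<in> {0..2*pi}"
  obtain \<eta> where \<eta>: "\<eta> \<longlonglongrightarrow> 0" "\<And>n s. s \<in> {0..2*pi} \<Longrightarrow> norm (increment n s - h s) \<le> \<eta> n"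
    using increment_uniform by blast
  have "(\<lambda>n. increment n s - h s) \<longlonglongrightarrow> 0"
    by (rule Lim_null_comparison[OF _ \<eta>(1)]) (use \<eta>(2) s in simp)
  then show ?thesis by (simp add: LIM_zero_iff)
qed

text \<open>
  By \<open>lagr_X0_plus\<close> the linear term is exact, and the remaining quadratic term is of order \<open>(\<epsilon> n)\<^sup>2\<close>.
\<close>
lemma lagr_difference_quotient:
  "(\<lambda>n. (lagr (Y n) - lagr (X0 \<alpha> \<beta>)) / \<epsilon> n) \<longlonglongrightarrow> - (\<alpha> - \<beta>) * (h (pi/2) + h (3*pi/2)) $ 1"
proof -
  have eq: "(lagr (Y n) - lagr (X0 \<alpha> \<beta>)) / \<epsilon> n =
      - (\<alpha> - \<beta>) * (increment n (pi/2) + increment n (3*pi/2)) $ 1 + lagr (\<lambda>s. \<epsilon> n *\<^sub>R increment n s) / \<epsilon> n" for n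
  proof -
    have "lagr (Y n) = lagr (X0 \<alpha> \<beta>) - (\<alpha> - \<beta>) * (\<epsilon> n *\<^sub>R increment n (pi/2) + \<epsilon> n *\<^sub>R increment n (3*pi/2)) $ 1
        + lagr (\<lambda>s. \<epsilon> n *\<^sub>R increment n s)"
      using lagr_X0_plus[OF H1_per_scaleR[OF increment_H1_per], of \<alpha> \<beta> "\<epsilon> n" n] by (simp only: Y_eq[symmetric])
    then show ?thesis using \<epsilon>_pos[of n] by (simp add: field_simps)
  qed
  have quad: "\<bar>lagr (\<lambda>s. \<epsilon> n *\<^sub>R increment n s) / \<epsilon> n\<bar> \<le>
      \<epsilon> n * ((H1_norm (\<lambda>s. increment n s - h s))\<^sup>2 + (H1_norm h)\<^sup>2)" for n
  proof -
    have "\<bar>lagr (\<lambda>s. \<epsilon> n *\<^sub>R increment n s)\<bar> \<le> (\<epsilon> n * H1_norm (increment n))\<^sup>2 / 2"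
      using abs_lagr_le[OF H1_per_scaleR[OF increment_H1_per], of "\<epsilon> n" n] \<epsilon>_pos[of n]
      by (simp add: H1_norm_scaleR increment_H1_per)
    also have "\<dots> = (\<epsilon> n)\<^sup>2 / 2 * (H1_norm (increment n))\<^sup>2"
      by (simp add: power_mult_distrib)
    also have "\<dots> \<le> (\<epsilon> n)\<^sup>2 / 2 * (2 * (H1_norm (\<lambda>s. increment n s - h s))\<^sup>2 + 2 * (H1_norm h)\<^sup>2)"
      using H1_norm_squared_add_le[OF H1_per_diff[OF increment_H1_per h] h, of n]
      by (intro mult_left_mono) auto
    finally show ?thesis
      using \<epsilon>_pos[of n] by (simp add: pos_divide_le_eq power2_eq_square algebra_simps)
  qed
  have "(\<lambda>n. \<epsilon> n * ((H1_norm (\<lambda>s. increment n s - h s))\<^sup>2 + (H1_norm h)\<^sup>2)) \<longlonglongrightarrow> 0 * (0\<^sup>2 + (H1_norm h)\<^sup>2)"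
    by (intro tendsto_intros \<epsilon>_lim increment_h_H1_norm)
  then have bound: "(\<lambda>n. \<epsilon> n * ((H1_norm (\<lambda>s. increment n s - h s))\<^sup>2 + (H1_norm h)\<^sup>2)) \<longlonglongrightarrow> 0"
    by (simp only: mult_zero_left)
  have "(\<lambda>n. lagr (\<lambda>s. \<epsilon> n *\<^sub>R increment n s) / \<epsilon> n) \<longlonglongrightarrow> 0"
    by (rule Lim_null_comparison[OF _ bound]) (simp only: real_norm_def quad eventually_True)
  then have "(\<lambda>n. - (\<alpha> - \<beta>) * (increment n (pi/2) + increment n (3*pi/2)) $ 1 + lagr (\<lambda>s. \<epsilon> n *\<^sub>R increment n s) / \<epsilon> n)
      \<longlonglongrightarrow> - (\<alpha> - \<beta>) * (h (pi/2) + h (3*pi/2)) $ 1 + 0"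
    by (intro tendsto_intros increment_pointwise) auto
  then show ?thesis by (simp add: eq)
qed

text \<open>
  The blow-up applied on the quarter period that starts at the zero \<open>p\<close> and runs in the direction
  \<open>\<sigma>\<close>: the limit of a transversal crossing, the conclusion for a degenerate one, and the sign of the
  integral. The scaled increments converge uniformly to the continuous function \<open>h\<close>, and therefore to \<open>h p\<close>
  at points approaching \<open>p\<close>.
\<close>
lemma quarter:
  assumes \<sigma>: "\<bar>\<sigma>\<bar> = 1" and p: "\<And>t. t \<in> {0..pi/2} \<Longrightarrow> p + \<sigma> * t \<in> {0..2*pi}"
    and "\<kappa> \<ge> 0" and "norm e = 1"
    and X0: "\<And>t. t \<in> {0..pi/2} \<Longrightarrow> X0 \<alpha> \<beta> (p + \<sigma> * t) = (\<kappa> * sin t) *\<^sub>R e"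
  shows "\<kappa> > 0 \<Longrightarrow> (\<lambda>n. (LINT t:{0..pi/2}|lborel. (Y n (p + \<sigma> * t) \<bullet> e) / norm (Y n (p + \<sigma> * t)) - 1) / \<epsilon> n)
      \<longlonglongrightarrow> (h p \<bullet> e - norm (h p)) / \<kappa>"
    and "\<kappa> = 0 \<Longrightarrow> (\<And>n. - B \<le> (LINT t:{0..pi/2}|lborel. (Y n (p + \<sigma> * t) \<bullet> e) / norm (Y n (p + \<sigma> * t)) - 1) / \<epsilon> n)
      \<Longrightarrow> h p \<bullet> e = norm (h p)"
    and "(LINT t:{0..pi/2}|lborel. (Y n (p + \<sigma> * t) \<bullet> e) / norm (Y n (p + \<sigma> * t)) - 1) / \<epsilon> n \<le> 0"
proof -
  obtain \<eta> where \<eta>: "\<eta> \<longlonglongrightarrow> 0" "\<And>n s. s \<in> {0..2*pi} \<Longrightarrow> norm (increment n s - h s) \<le> \<eta> n"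
    using increment_uniform by blast
  have hc: "continuous_on UNIV h" using h by (simp add: H1_per_def)
  obtain C1 where C1: "\<And>n. norm (\<eta> n) \<le> C1"
    using convergent_imp_Bseq[OF convergentI[OF \<eta>(1)]] by (auto simp: Bseq_def)
  obtain C2 where C2: "\<And>s. s \<in> {0..2*pi} \<Longrightarrow> norm (h s) \<le> C2"
    using compact_imp_bounded[OF compact_continuous_image[OF continuous_on_subset[OF hc subset_UNIV] compact_Icc]]
    unfolding bounded_iff by (metis imageI)
  interpret blow_up \<kappa> e "h p" \<epsilon> "\<lambda>n t. increment n (p + \<sigma> * t)" "C1 + C2"
  proof
    fix n
    have "continuous_on UNIV (increment n)" using increment_H1_per[of n] by (simp add: H1_per_def)
    then have "continuous_on UNIV (\<lambda>t. increment n (p + \<sigma> * t))"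
      by (rule continuous_on_compose2) (auto intro!: continuous_intros)
    then show "(\<lambda>t. increment n (p + \<sigma> * t)) \<in> borel_measurable borel"
      by (rule borel_measurable_continuous_onI)
    fix t :: real assume "t \<in> {0..pi/2}"
    from p[OF this] have "norm (increment n (p + \<sigma> * t) - h (p + \<sigma> * t)) \<le> \<eta> n" "norm (h (p + \<sigma> * t)) \<le> C2"
      by (auto intro: \<eta>(2) C2)
    then show "norm (increment n (p + \<sigma> * t)) \<le> C1 + C2"
      using C1[of n] norm_triangle_ineq[of "increment n (p + \<sigma> * t) - h (p + \<sigma> * t)" "h (p + \<sigma> * t)"] by simp
  next
    fix t :: real assume t: "t \<ge> 0"
    have \<epsilon>t: "(\<lambda>n. \<epsilon> n * t) \<longlonglongrightarrow> 0"
      using tendsto_mult_right[OF \<epsilon>_lim, of t] by simp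
    have "eventually (\<lambda>n. \<epsilon> n * t < pi/2) sequentially"
      by (rule order_tendstoD(2)[OF \<epsilon>t]) simp
    then have "eventually (\<lambda>n. norm (increment n (p + \<sigma> * (\<epsilon> n * t)) - h (p + \<sigma> * (\<epsilon> n * t))) \<le> \<eta> n) sequentially"
      by eventually_elim (use t \<epsilon>_pos in \<open>auto intro!: \<eta>(2) p simp: less_imp_le\<close>)
    then have 1: "(\<lambda>n. increment n (p + \<sigma> * (\<epsilon> n * t)) - h (p + \<sigma> * (\<epsilon> n * t))) \<longlonglongrightarrow> 0"
      by (rule Lim_null_comparison[OF _ \<eta>(1)])
    have "isCont h p" using hc by (simp add: continuous_on_eq_continuous_at)
    moreover have "(\<lambda>n. p + \<sigma> * (\<epsilon> n * t)) \<longlonglongrightarrow> p"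
      using tendsto_add[OF tendsto_const tendsto_mult_left[OF \<epsilon>t], of p \<sigma>] by simp
    ultimately have "(\<lambda>n. h (p + \<sigma> * (\<epsilon> n * t))) \<longlonglongrightarrow> h p"
      by (rule isCont_tendsto_compose)
    from tendsto_add[OF 1 this] show "(\<lambda>n. increment n (p + \<sigma> * (\<epsilon> n * t))) \<longlonglongrightarrow> h p" by simp
  qed (use assms \<epsilon>_pos \<epsilon>_lim in auto)
  have eq: "(LINT t:{0..pi/2}|lborel. (Y n (p + \<sigma> * t) \<bullet> e) / norm (Y n (p + \<sigma> * t)) - 1) = (LINT t:{0..pi/2}|lborel. deficit n t)" for n
    by (intro set_lebesgue_integral_cong allI impI) (simp_all add: deficit_def profile_def Y_eq X0)
  show "\<kappa> > 0 \<Longrightarrow> (\<lambda>n. (LINT t:{0..pi/2}|lborel. (Y n (p + \<sigma> * t) \<bullet> e) / norm (Y n (p + \<sigma> * t)) - 1) / \<epsilon> n)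
      \<longlonglongrightarrow> (h p \<bullet> e - norm (h p)) / \<kappa>"
    unfolding eq by (rule limit_transversal)
  show "\<kappa> = 0 \<Longrightarrow> (\<And>n. - B \<le> (LINT t:{0..pi/2}|lborel. (Y n (p + \<sigma> * t) \<bullet> e) / norm (Y n (p + \<sigma> * t)) - 1) / \<epsilon> n)
      \<Longrightarrow> h p \<bullet> e = norm (h p)"
    unfolding eq by (rule limit_degenerate)
  have "0 \<le> (LINT t:{0..pi/2}|lborel. - deficit n t)"
    unfolding set_lebesgue_integral_def using deficit_bounds(2) by (intro integral_nonneg_AE AE_I2) (simp add: indicator_def)
  then have "(LINT t:{0..pi/2}|lborel. deficit n t) \<le> 0"
    by (simp add: set_lebesgue_integral_def)
  then show "(LINT t:{0..pi/2}|lborel. (Y n (p + \<sigma> * t) \<bullet> e) / norm (Y n (p + \<sigma> * t)) - 1) / \<epsilon> n \<le> 0"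
    unfolding eq using \<epsilon>_pos[of n] by (simp add: divide_nonpos_pos)
qed

definition first_direction :: "nat \<Rightarrow> real \<Rightarrow> real" where "first_direction n s = Y n s $ 1 / norm (Y n s)"

lemma Y_measurable [measurable]: "Y n \<in> borel_measurable borel"
  using Y[of n] by (simp add: H1_per_def borel_measurable_continuous_onI)

lemma first_direction_set_integrable: "set_integrable lborel {a..b} (first_direction n)"
proof (rule set_integrable_bound)
  show "set_integrable lborel {a..b} (\<lambda>_. 1::real)"
    by (intro borel_integrable_atLeastAtMost' continuous_intros)
  have "(\<lambda>s. Y n s \<bullet> axis 1 1 / norm (Y n s)) \<in> borel_measurable borel" by measurable
  then have "first_direction n \<in> borel_measurable borel" by (simp add: first_direction_def[abs_def] inner_axis)
  then show "set_borel_measurable lborel {a..b} (first_direction n)"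
    unfolding set_borel_measurable_def by simp
  have "\<bar>first_direction n s\<bar> \<le> 1" for s
    using cosine_le_1[of "axis 1 1 :: real^3" "Y n s"] by (simp add: first_direction_def inner_axis)
  then show "AE s in lborel. s \<in> {a..b} \<longrightarrow> norm (first_direction n s) \<le> norm (1::real)" by simp
qed

lemma constraint_eq: "constraint_integral (Y n) $ 1 = (LINT s:{0..2*pi}|lborel. first_direction n s)"
proof -
  have "set_integrable lborel {0..2*pi} (\<lambda>s. Y n s /\<^sub>R norm (Y n s))"
  proof (rule set_integrable_bound)
    show "set_integrable lborel {0..2*pi} (\<lambda>_. 1::real)"
      by (intro borel_integrable_atLeastAtMost' continuous_intros)
    show "set_borel_measurable lborel {0..2*pi} (\<lambda>s. Y n s /\<^sub>R norm (Y n s))"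
      unfolding set_borel_measurable_def by measurable
    have "norm (Y n s /\<^sub>R norm (Y n s)) \<le> 1" for s
      by (cases "Y n s = 0") auto
    then show "AE s in lborel. s \<in> {0..2*pi} \<longrightarrow> norm (Y n s /\<^sub>R norm (Y n s)) \<le> norm (1::real)"
      by simp
  qed
  from set_integral_vec_nth(2)[OF this, of 1] show ?thesis
    by (simp add: constraint_integral_def first_direction_def[abs_def] divide_inverse mult.commute)
qed

text \<open>
  Each of the four quarter periods ends at one of the zeros. The unperturbed curve points along
  \<open>e\<^sub>1\<close> on the outer two and, when \<open>\<beta> > 0\<close>, along \<open>-e\<^sub>1\<close> on the inner two. The zeroth-order contributions
  \<open>\<plusminus>\<pi>/2\<close> cancel, and the first-order ones are given by \<open>quarter\<close>.
\<close>
lemma balance: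
  assumes con: "(\<lambda>n. constraint_integral (Y n) $ 1 / \<epsilon> n) \<longlonglongrightarrow> 0"
  shows "(\<alpha> + \<beta>) * (h (pi/2) + h (3*pi/2)) $ 1 = - (\<alpha> - \<beta>) * (norm (h (pi/2)) + norm (h (3*pi/2)))"
proof -
  define e :: "real^3" where "e = axis 1 1"
  have e: "norm e = 1" "norm (- e) = 1" by (simp_all add: e_def)
  have ve: "v \<bullet> e = v $ 1" for v by (simp add: e_def inner_axis)
  define I1 I2 I3 I4 where
    "I1 n = (LINT s:{0..pi/2}|lborel. first_direction n s)" and "I2 n = (LINT s:{pi/2..pi}|lborel. first_direction n s)" and
    "I3 n = (LINT s:{pi..3*pi/2}|lborel. first_direction n s)" and "I4 n = (LINT s:{3*pi/2..2*pi}|lborel. first_direction n s)" for n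
  have total: "constraint_integral (Y n) $ 1 = I1 n + I2 n + I3 n + I4 n" for n
    unfolding constraint_eq I1_def I2_def I3_def I4_def
    using set_integral_combine[OF _ _ first_direction_set_integrable, of 0 "pi/2" "2*pi" n]
      set_integral_combine[OF _ _ first_direction_set_integrable, of "pi/2" "pi" "2*pi" n]
      set_integral_combine[OF _ _ first_direction_set_integrable, of "pi" "3*pi/2" "2*pi" n] by simp
  have minus_1: "(LINT s:{a..b}|lborel. \<tau> * first_direction n s - 1) = \<tau> * (LINT s:{a..b}|lborel. first_direction n s) - (b - a)"
    if "a \<le> b" for a b \<tau> n
  proof -
    have "set_integrable lborel {a..b} (\<lambda>_. 1::real)"
      by (intro borel_integrable_atLeastAtMost' continuous_intros)
    moreover have "set_integrable lborel {a..b} (\<lambda>s. \<tau> * first_direction n s)"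
      using first_direction_set_integrable by simp
    ultimately show ?thesis
      using that by (simp add: set_integral_diff(2)) (simp add: set_lebesgue_integral_def)
  qed
  have cosine: "(v \<bullet> (\<tau> *\<^sub>R e)) / norm v = \<tau> * (v $ 1 / norm v)" for v \<tau>
    by (simp add: ve)
  have reflect: "(LINT t:{0..pi/2}|lborel. (Y n (p + (-1) * t) \<bullet> (\<tau> *\<^sub>R e)) / norm (Y n (p + (-1) * t)) - 1) =
      \<tau> * (LINT s:{p - pi/2..p}|lborel. first_direction n s) - pi/2" for n p \<tau>
    using set_integral_reflect[of p "pi/2" "\<lambda>s. \<tau> * first_direction n s - 1"] minus_1[of "p - pi/2" p \<tau> n]
    unfolding cosine first_direction_def[symmetric] by simp
  have shift: "(LINT t:{0..pi/2}|lborel. (Y n (p + 1 * t) \<bullet> (\<tau> *\<^sub>R e)) / norm (Y n (p + 1 * t)) - 1) =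
      \<tau> * (LINT s:{p..p + pi/2}|lborel. first_direction n s) - pi/2" for n p \<tau>
    using set_integral_shift[of p "pi/2" "\<lambda>s. \<tau> * first_direction n s - 1"] minus_1[of p "p + pi/2" \<tau> n]
    unfolding cosine first_direction_def[symmetric] by simp
  have ends: "pi/2 - pi/2 = 0" "pi/2 + pi/2 = pi" "3*pi/2 - pi/2 = pi" "3*pi/2 + pi/2 = 2*pi"
    by simp_all
  have S1: "(LINT t:{0..pi/2}|lborel. (Y n (pi/2 + (-1) * t) \<bullet> e) / norm (Y n (pi/2 + (-1) * t)) - 1) = I1 n - pi/2"
    and S4: "(LINT t:{0..pi/2}|lborel. (Y n (3*pi/2 + 1 * t) \<bullet> e) / norm (Y n (3*pi/2 + 1 * t)) - 1) = I4 n - pi/2"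
    and S2: "(LINT t:{0..pi/2}|lborel. (Y n (pi/2 + 1 * t) \<bullet> (- e)) / norm (Y n (pi/2 + 1 * t)) - 1) = - I2 n - pi/2"
    and S3: "(LINT t:{0..pi/2}|lborel. (Y n (3*pi/2 + (-1) * t) \<bullet> (- e)) / norm (Y n (3*pi/2 + (-1) * t)) - 1) = - I3 n - pi/2"
    for n
    using reflect[where n = n and p = "pi/2" and \<tau> = 1] shift[where n = n and p = "3*pi/2" and \<tau> = 1]
      shift[where n = n and p = "pi/2" and \<tau> = "-1"] reflect[where n = n and p = "3*pi/2" and \<tau> = "-1"]
    unfolding ends I1_def I2_def I3_def I4_def scaleR_minus1_left scaleR_one by simp_all
  have X0: "X0 \<alpha> \<beta> (pi/2 + (-1) * t) = (\<alpha> * sin t) *\<^sub>R e" "X0 \<alpha> \<beta> (3*pi/2 + 1 * t) = (\<alpha> * sin t) *\<^sub>R e"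
      "X0 \<alpha> \<beta> (pi/2 + 1 * t) = (\<beta> * sin t) *\<^sub>R (- e)" "X0 \<alpha> \<beta> (3*pi/2 + (-1) * t) = (\<beta> * sin t) *\<^sub>R (- e)"
    if "t \<in> {0..pi/2}" for t
  proof -
    have "sin t \<ge> 0" using that by (intro sin_ge_zero) auto
    then show "X0 \<alpha> \<beta> (pi/2 + (-1) * t) = (\<alpha> * sin t) *\<^sub>R e" "X0 \<alpha> \<beta> (3*pi/2 + 1 * t) = (\<alpha> * sin t) *\<^sub>R e"
      "X0 \<alpha> \<beta> (pi/2 + 1 * t) = (\<beta> * sin t) *\<^sub>R (- e)" "X0 \<alpha> \<beta> (3*pi/2 + (-1) * t) = (\<beta> * sin t) *\<^sub>R (- e)"
      by (simp_all add: X0_eq cos_ab_eq cos_add cos_diff cos_3pi_half sin_3pi_half e_def)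
  qed
  have dom: "pi/2 + (-1) * t \<in> {0..2*pi}" "3*pi/2 + 1 * t \<in> {0..2*pi}"
      "pi/2 + 1 * t \<in> {0..2*pi}" "3*pi/2 + (-1) * t \<in> {0..2*pi}" if "t \<in> {0..pi/2}" for t
    using that by auto
  have sign: "\<bar>-1\<bar> = (1::real)" "\<bar>1\<bar> = (1::real)" by simp_all
  define A1 A2 N1 N2 where "A1 = h (pi/2) $ 1" and "A2 = h (3*pi/2) $ 1"
    and "N1 = norm (h (pi/2))" and "N2 = norm (h (3*pi/2))"
  note A = A1_def[symmetric] A2_def[symmetric] N1_def[symmetric] N2_def[symmetric]
  have L1: "(\<lambda>n. (I1 n - pi/2) / \<epsilon> n) \<longlonglongrightarrow> (A1 - N1) / \<alpha>"
    by (rule quarter(1)[OF sign(1) dom(1) less_imp_le[OF \<alpha>] e(1) X0(1) \<alpha>, unfolded S1, unfolded ve A])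
  have L4: "(\<lambda>n. (I4 n - pi/2) / \<epsilon> n) \<longlonglongrightarrow> (A2 - N2) / \<alpha>"
    by (rule quarter(1)[OF sign(2) dom(2) less_imp_le[OF \<alpha>] e(1) X0(2) \<alpha>, unfolded S4, unfolded ve A])
  have split: "constraint_integral (Y n) $ 1 / \<epsilon> n =
      (I1 n - pi/2) / \<epsilon> n + (I4 n - pi/2) / \<epsilon> n - (- I2 n - pi/2) / \<epsilon> n - (- I3 n - pi/2) / \<epsilon> n" for n
  proof -
    have "I1 n + I2 n + I3 n + I4 n = (I1 n - pi/2) + (I4 n - pi/2) - (- I2 n - pi/2) - (- I3 n - pi/2)" by simp
    then show ?thesis
      unfolding total by (simp only: add_divide_distrib diff_divide_distrib)
  qed
  have "(\<alpha> + \<beta>) * (A1 + A2) = - (\<alpha> - \<beta>) * (N1 + N2)"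
  proof (cases "\<beta> > 0")
    case True
    have L2: "(\<lambda>n. (- I2 n - pi/2) / \<epsilon> n) \<longlonglongrightarrow> (- A1 - N1) / \<beta>"
      by (rule quarter(1)[OF sign(2) dom(3) \<beta> e(2) X0(3) True, unfolded S2, unfolded inner_minus_right ve A])
    have L3: "(\<lambda>n. (- I3 n - pi/2) / \<epsilon> n) \<longlonglongrightarrow> (- A2 - N2) / \<beta>"
      by (rule quarter(1)[OF sign(1) dom(4) \<beta> e(2) X0(4) True, unfolded S3, unfolded inner_minus_right ve A])
    have "(\<lambda>n. constraint_integral (Y n) $ 1 / \<epsilon> n) \<longlonglongrightarrow>
        (A1 - N1) / \<alpha> + (A2 - N2) / \<alpha> - (- A1 - N1) / \<beta> - (- A2 - N2) / \<beta>"
      unfolding split by (intro tendsto_intros L1 L2 L3 L4)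
    note limit = LIMSEQ_unique[OF this con]
    have cancel: "\<alpha> * \<beta> * (x / \<alpha>) = \<beta> * x" "\<alpha> * \<beta> * (x / \<beta>) = \<alpha> * x" for x
      using True \<alpha> by simp_all
    have "\<alpha> * \<beta> * ((A1 - N1) / \<alpha> + (A2 - N2) / \<alpha> - (- A1 - N1) / \<beta> - (- A2 - N2) / \<beta>) =
        \<beta> * (A1 - N1) + \<beta> * (A2 - N2) - \<alpha> * (- A1 - N1) - \<alpha> * (- A2 - N2)"
      by (simp only: distrib_left[of "\<alpha> * \<beta>"] right_diff_distrib[of "\<alpha> * \<beta>"] cancel)
    then show ?thesis
      unfolding limit by (simp add: algebra_simps)
  next
    case False
    then have \<beta>0: "\<beta> = 0" using \<beta> by simp
    \<comment> \<open>The scaled deficits of the two inner quarters together converge, since the constraint fixes it in terms of the outer quarters; both parts have the same sign, so each of them is bounded.\<close>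
    define K where "K n = (- I2 n - pi/2) / \<epsilon> n + (- I3 n - pi/2) / \<epsilon> n" for n
    have cancel: "x + y = a + b - (a + b - x - y)" for a b x y :: real by simp
    have "K = (\<lambda>n. (I1 n - pi/2) / \<epsilon> n + (I4 n - pi/2) / \<epsilon> n - constraint_integral (Y n) $ 1 / \<epsilon> n)"
    proof
      fix n show "K n = (I1 n - pi/2) / \<epsilon> n + (I4 n - pi/2) / \<epsilon> n - constraint_integral (Y n) $ 1 / \<epsilon> n"
        unfolding split K_def by (rule cancel)
    qed
    then have "convergent K"
      using tendsto_diff[OF tendsto_add[OF L1 L4] con] by (metis convergentI)
    then obtain B where B: "\<And>n. \<bar>K n\<bar> \<le> B"
      using convergent_imp_Bseq[of K] by (auto simp: Bseq_def)
    have le2: "(- I2 n - pi/2) / \<epsilon> n \<le> 0" for n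
      by (rule quarter(3)[OF sign(2) dom(3) \<beta> e(2) X0(3), unfolded S2])
    have le3: "(- I3 n - pi/2) / \<epsilon> n \<le> 0" for n
      by (rule quarter(3)[OF sign(1) dom(4) \<beta> e(2) X0(4), unfolded S3])
    have lower: "- b \<le> x \<and> - b \<le> y" if "\<bar>x + y\<bar> \<le> b" "x \<le> 0" "y \<le> 0" for b x y :: real
      using that by linarith
    have low: "- B \<le> (- I2 n - pi/2) / \<epsilon> n \<and> - B \<le> (- I3 n - pi/2) / \<epsilon> n" for n
    proof (rule lower)
      show "\<bar>(- I2 n - pi/2) / \<epsilon> n + (- I3 n - pi/2) / \<epsilon> n\<bar> \<le> B"
        using B[of n] by (simp only: K_def)
    qed (rule le2 le3)+
    have "- A1 = N1"
      by (rule quarter(2)[OF sign(2) dom(3) \<beta> e(2) X0(3) \<beta>0, unfolded S2, unfolded inner_minus_right ve A],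
          assumption, assumption, rule low[THEN conjunct1])
    moreover have "- A2 = N2"
      by (rule quarter(2)[OF sign(1) dom(4) \<beta> e(2) X0(4) \<beta>0, unfolded S3, unfolded inner_minus_right ve A],
          assumption, assumption, rule low[THEN conjunct2])
    ultimately have A12: "A1 + A2 = - (N1 + N2)" by simp
    show ?thesis
      unfolding \<beta>0 A12 by (simp only: add_0_right diff_zero mult_minus_left mult_minus_right)
  qed
  then show ?thesis by (simp add: A)
qed

end

section \<open>The sign of the first variation\<close>

theorem proposition3p1:
  fixes \<alpha> \<beta> L1 :: real and M :: "real set"
    and X :: "real \<Rightarrow> real \<Rightarrow> real^3" and x1 :: "real \<Rightarrow> real^3"
  assumes "\<alpha> > 0" and "0 \<le> \<beta>" and "\<beta> \<le> \<alpha>"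
    and "is_interval M" and "0 \<in> M" and "M \<noteq> {0}"
    and "x1 \<in> H1_per"
    and "\<And>\<mu>. \<mu> \<in> M \<Longrightarrow> \<mu> \<noteq> 0 \<Longrightarrow> X \<mu> \<in> H1_per"
    and "\<And>\<mu>. \<mu> \<in> M \<Longrightarrow> \<mu> \<noteq> 0 \<Longrightarrow> AE s in lborel. X \<mu> s \<noteq> 0"
    and "(\<lambda>\<mu>. H1_norm (\<lambda>s. X \<mu> s - X0 \<alpha> \<beta> s - \<mu> *\<^sub>R x1 s)) \<in> o[at 0 within M](\<lambda>\<mu>. \<mu>)"
    and "(\<lambda>\<mu>. lagr (X \<mu>) - lagr (X0 \<alpha> \<beta>) - \<mu> * L1) \<in> o[at 0 within M](\<lambda>\<mu>. \<mu>)"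
    and "(\<lambda>\<mu>. constraint_integral (X \<mu>) $ 1) \<in> o[at 0 within M](\<lambda>\<mu>. \<mu>)"
  shows "(\<forall>\<mu>\<in>M. 0 \<le> \<mu> * L1) \<and>
    (\<not> ((\<alpha> = \<beta> \<and> \<beta> > 0) \<or> (x1 (pi/2) = 0 \<and> x1 (3*pi/2) = 0)) \<longrightarrow>
       (\<forall>\<mu>\<in>M. \<mu> \<noteq> 0 \<longrightarrow> 0 < \<mu> * L1))"
proof -
  \<comment> \<open>Since \<open>M\<close> is an interval containing \<open>0\<close> and \<open>m\<close>, it contains the sequence \<open>m / (n + 1)\<close>.\<close>
  have key: "(\<alpha> + \<beta>) * (m * L1) = (\<alpha> - \<beta>)\<^sup>2 * \<bar>m\<bar> * (norm (x1 (pi/2)) + norm (x1 (3*pi/2)))"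
    if m: "m \<in> M" "m \<noteq> 0" for m
  proof -
    define \<epsilon> where "\<epsilon> n = 1 / real (Suc n)" for n
    define \<mu> where "\<mu> n = \<epsilon> n * m" for n
    have \<epsilon>: "\<epsilon> n > 0" "\<epsilon> n \<le> 1" for n by (simp_all add: \<epsilon>_def)
    have \<epsilon>_lim: "\<epsilon> \<longlonglongrightarrow> 0"
      unfolding \<epsilon>_def[abs_def] using LIMSEQ_inverse_real_of_nat by (simp add: inverse_eq_divide)
    have \<mu>M: "\<mu> n \<in> M" for n
    proof -
      have "(1 - \<epsilon> n) *\<^sub>R 0 + \<epsilon> n *\<^sub>R m \<in> M"
        using \<epsilon>[of n] assms(4,5) m(1)
        by (intro convexD[OF is_interval_convex]) auto
      then show ?thesis by (simp add: \<mu>_def)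
    qed
    have \<mu>0: "\<mu> n \<noteq> 0" for n using \<epsilon>[of n] m by (simp add: \<mu>_def)
    have "\<mu> \<longlonglongrightarrow> 0"
      unfolding \<mu>_def[abs_def] using tendsto_mult_right[OF \<epsilon>_lim, of m] by simp
    then have at0: "filterlim \<mu> (at 0 within M) sequentially"
      using \<mu>M \<mu>0 by (auto simp: filterlim_at)
    have small: "(\<lambda>n. u (\<mu> n) / \<epsilon> n) \<longlonglongrightarrow> 0" if "u \<in> o[at 0 within M](\<lambda>\<mu>. \<mu>)" for u :: "real \<Rightarrow> real"
    proof -
      have "((\<lambda>\<mu>. u \<mu> / \<mu>) \<longlongrightarrow> 0) (at 0 within M)"
        using that by (rule smalloD_tendsto)
      from tendsto_mult_left[OF filterlim_compose[OF this at0], of m]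
      have "(\<lambda>n. m * (u (\<mu> n) / \<mu> n)) \<longlonglongrightarrow> 0" by simp
      then show ?thesis using m(2) by (simp add: \<mu>_def)
    qed
    interpret perturbed_sequence \<alpha> \<beta> "\<lambda>s. m *\<^sub>R x1 s" \<epsilon> "\<lambda>n. X (\<mu> n)"
    proof
      show "(\<lambda>n. H1_norm (\<lambda>s. X (\<mu> n) s - X0 \<alpha> \<beta> s - \<epsilon> n *\<^sub>R m *\<^sub>R x1 s) / \<epsilon> n) \<longlonglongrightarrow> 0"
        using small[OF assms(10)] by (simp add: \<mu>_def)
    qed (use assms \<mu>M \<mu>0 \<epsilon> \<epsilon>_lim H1_per_scaleR in auto)
    have "(\<lambda>n. (lagr (X (\<mu> n)) - lagr (X0 \<alpha> \<beta>) - \<mu> n * L1) / \<epsilon> n + m * L1) \<longlonglongrightarrow> 0 + m * L1"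
      by (intro tendsto_intros small[OF assms(11)])
    moreover have "(lagr (X (\<mu> n)) - lagr (X0 \<alpha> \<beta>) - \<mu> n * L1) / \<epsilon> n + m * L1 = (lagr (X (\<mu> n)) - lagr (X0 \<alpha> \<beta>)) / \<epsilon> n" for n
      using \<epsilon>[of n] by (simp add: \<mu>_def diff_divide_distrib)
    ultimately have "m * L1 = - (\<alpha> - \<beta>) * (m *\<^sub>R x1 (pi/2) + m *\<^sub>R x1 (3*pi/2)) $ 1"
      using LIMSEQ_unique[OF _ lagr_difference_quotient] by simp
    then have "(\<alpha> + \<beta>) * (m * L1) = - (\<alpha> - \<beta>) * ((\<alpha> + \<beta>) * (m *\<^sub>R x1 (pi/2) + m *\<^sub>R x1 (3*pi/2)) $ 1)"
      by simp
    also have "\<dots> = (\<alpha> - \<beta>)\<^sup>2 * (norm (m *\<^sub>R x1 (pi/2)) + norm (m *\<^sub>R x1 (3*pi/2)))"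
      unfolding balance[OF small[OF assms(12)]]
      by (simp only: power2_eq_square mult_minus_left mult_minus_right minus_minus mult.assoc)
    finally show ?thesis by (simp add: distrib_left)
  qed
  have pos: "\<alpha> + \<beta> > 0" using assms(1,2) by simp
  have "0 \<le> m * L1" if "m \<in> M" for m
  proof (cases "m = 0")
    case False
    have "0 \<le> (\<alpha> + \<beta>) * (m * L1)"
      unfolding key[OF that False] by (intro mult_nonneg_nonneg) auto
    then show ?thesis using pos by (simp add: zero_le_mult_iff)
  qed simp
  moreover have "0 < m * L1"
    if "\<not> ((\<alpha> = \<beta> \<and> \<beta> > 0) \<or> (x1 (pi/2) = 0 \<and> x1 (3*pi/2) = 0))" "m \<in> M" "m \<noteq> 0" for m
  proof -
    have "\<alpha> \<noteq> \<beta>" using that(1) assms(1) by auto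
    moreover have "norm (x1 (pi/2)) + norm (x1 (3*pi/2)) > 0"
      using that(1) by (auto simp: add_nonneg_pos add_pos_nonneg)
    ultimately have "0 < (\<alpha> + \<beta>) * (m * L1)"
      unfolding key[OF that(2,3)] using that(3) by simp
    then show ?thesis using pos by (simp add: zero_less_mult_iff)
  qed
  ultimately show ?thesis by blast
qed

end
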